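(* Let $W$ be the Weyl group of an irreducible (reduced) crystallographic root system of rank $n$, let $w_0$ be its longest element, and let $\mathscr{L}:W\to\mathbb{N}$ be the atomic length. Then $\mathscr{L}(W)=\{0,1,\dots,\mathscr{L}(w_0)\}$, i.e. the map $\mathscr{L}:W\to\{0,1,\dots,\mathscr{L}(w_0)\}$ is surjective, if and only if $n\neq 2$.
   Context: $\Phi$ is an irreducible reduced crystallographic root system of rank $n$ with simple roots $\alpha_1,\dots,\alpha_n$, positive roots $\Phi^+$ and negative roots $\Phi^-=-\Phi^+$; $W$ is its (finite) Weyl group, generated by the simple reflections $s_i=s_{\alpha_i}$, and $w_0$ is the unique element of $W$ of maximal Coxeter length. The height of a root $\alpha=\sum_i a_i\alpha_i$ is $\mathrm{ht}(\alpha)=\sum_i a_i$. The inversion set of $w\in W$ is $N(w)=\{\alpha\in\Phi^+\mid w^{-1}(\alpha)\in\Phi^-\}$. The atomic length of $w$ is $\mathscr{L}(w)=\sum_{\alpha\in N(w)}\mathrm{ht}(\alpha)$. (The element $w_0$ realises the maximal value of $\mathscr{L}$ on $W$.) $\mathbb{N}$ denotes the nonnegative integers. *)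

theory Defs
  imports "HOL-Analysis.Analysis"
begin

definition reflection :: "'a::real_inner \<Rightarrow> 'a \<Rightarrow> 'a" where
  "reflection \<alpha> x = x - (2 * (x \<bullet> \<alpha>) / (\<alpha> \<bullet> \<alpha>)) *\<^sub>R \<alpha>"

(* Reduced crystallographic root systems. Since they span the ambient Euclidean space,
   the rank is dim \<Phi> = DIM('a). *)
locale root_system =
  fixes \<Phi> :: "'a::euclidean_space set"
  assumes finite_roots: "finite \<Phi>"
    and zero_not_root: "0 \<notin> \<Phi>"
    and span_roots: "span \<Phi> = UNIV"
    and reflection_root: "\<lbrakk>\<alpha> \<in> \<Phi>; \<beta> \<in> \<Phi>\<rbrakk> \<Longrightarrow> reflection \<alpha> \<beta> \<in> \<Phi>"
    and crystallographic: "\<lbrakk>\<alpha> \<in> \<Phi>; \<beta> \<in> \<Phi>\<rbrakk> \<Longrightarrow> 2 * (\<beta> \<bullet> \<alpha>) / (\<alpha> \<bullet> \<alpha>) \<in> \<int>"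
    and reduced: "\<lbrakk>\<alpha> \<in> \<Phi>; c *\<^sub>R \<alpha> \<in> \<Phi>\<rbrakk> \<Longrightarrow> c = 1 \<or> c = - 1"

definition irreducible_roots :: "'a::real_inner set \<Rightarrow> bool" where
  "irreducible_roots \<Phi> \<longleftrightarrow> \<Phi> \<noteq> {} \<and>
     \<not> (\<exists>A B. A \<noteq> {} \<and> B \<noteq> {} \<and> A \<inter> B = {} \<and> A \<union> B = \<Phi> \<and> (\<forall>\<alpha>\<in>A. \<forall>\<beta>\<in>B. \<alpha> \<bullet> \<beta> = 0))"

(* \<Delta> is a set of simple roots; the coordinate of v at \<delta> is representation \<Delta> v \<delta>. *)
definition simple_roots :: "'a::euclidean_space set \<Rightarrow> 'a set \<Rightarrow> bool" where
  "simple_roots \<Phi> \<Delta> \<longleftrightarrow> \<Delta> \<subseteq> \<Phi> \<and> independent \<Delta> \<and> span \<Delta> = UNIV \<and>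
     (\<forall>\<alpha>\<in>\<Phi>. (\<forall>\<delta>\<in>\<Delta>. representation \<Delta> \<alpha> \<delta> \<in> \<int>) \<and>
        ((\<forall>\<delta>\<in>\<Delta>. representation \<Delta> \<alpha> \<delta> \<ge> 0) \<or> (\<forall>\<delta>\<in>\<Delta>. representation \<Delta> \<alpha> \<delta> \<le> 0)))"

definition positive_roots :: "'a::euclidean_space set \<Rightarrow> 'a set \<Rightarrow> 'a set" where
  "positive_roots \<Phi> \<Delta> = {\<alpha> \<in> \<Phi>. \<forall>\<delta>\<in>\<Delta>. representation \<Delta> \<alpha> \<delta> \<ge> 0}"

definition negative_roots :: "'a::euclidean_space set \<Rightarrow> 'a set \<Rightarrow> 'a set" where
  "negative_roots \<Phi> \<Delta> = uminus ` positive_roots \<Phi> \<Delta>"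

(* The coordinates of a root are integers, so the floor only adjusts the type;
   see of_int_height below. *)
definition height :: "'a::euclidean_space set \<Rightarrow> 'a \<Rightarrow> int" where
  "height \<Delta> \<alpha> = (\<Sum>\<delta>\<in>\<Delta>. \<lfloor>representation \<Delta> \<alpha> \<delta>\<rfloor>)"

definition word_product :: "'a::real_inner list \<Rightarrow> 'a \<Rightarrow> 'a" where
  "word_product \<delta>s = foldr (\<lambda>\<delta> w. reflection \<delta> \<circ> w) \<delta>s id"

(* The generators are involutions, so the words in them form a group under composition. *)
definition weyl_group :: "'a::real_inner set \<Rightarrow> ('a \<Rightarrow> 'a) set" where
  "weyl_group \<Delta> = {word_product \<delta>s |\<delta>s. set \<delta>s \<subseteq> \<Delta>}"

definition coxeter_length :: "'a::real_inner set \<Rightarrow> ('a \<Rightarrow> 'a) \<Rightarrow> nat" where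
  "coxeter_length \<Delta> w =
     (LEAST k. \<exists>\<delta>s. set \<delta>s \<subseteq> \<Delta> \<and> length \<delta>s = k \<and> word_product \<delta>s = w)"

definition longest_element :: "'a::real_inner set \<Rightarrow> ('a \<Rightarrow> 'a) \<Rightarrow> bool" where
  "longest_element \<Delta> w0 \<longleftrightarrow>
     w0 \<in> weyl_group \<Delta> \<and> (\<forall>w\<in>weyl_group \<Delta>. coxeter_length \<Delta> w \<le> coxeter_length \<Delta> w0)"

definition inversion_set ::
    "'a::euclidean_space set \<Rightarrow> 'a set \<Rightarrow> ('a \<Rightarrow> 'a) \<Rightarrow> 'a set" where
  "inversion_set \<Phi> \<Delta> w = {\<alpha> \<in> positive_roots \<Phi> \<Delta>. inv w \<alpha> \<in> negative_roots \<Phi> \<Delta>}"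

(* Heights of positive roots are nonnegative, so nat only adjusts the type;
   see of_nat_atomic_length below. *)
definition atomic_length ::
    "'a::euclidean_space set \<Rightarrow> 'a set \<Rightarrow> ('a \<Rightarrow> 'a) \<Rightarrow> nat" where
  "atomic_length \<Phi> \<Delta> w = nat (\<Sum>\<alpha>\<in>inversion_set \<Phi> \<Delta> w. height \<Delta> \<alpha>)"

lemma of_int_height:
  assumes "simple_roots \<Phi> \<Delta>" "\<alpha> \<in> \<Phi>"
  shows "real_of_int (height \<Delta> \<alpha>) = (\<Sum>\<delta>\<in>\<Delta>. representation \<Delta> \<alpha> \<delta>)"
  using assms unfolding height_def simple_roots_def of_int_sum
  by (intro sum.cong) auto

lemma of_nat_atomic_length:
  "int (atomic_length \<Phi> \<Delta> w) = (\<Sum>\<alpha>\<in>inversion_set \<Phi> \<Delta> w. height \<Delta> \<alpha>)"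
proof -
  have "(\<Sum>\<alpha>\<in>inversion_set \<Phi> \<Delta> w. height \<Delta> \<alpha>) \<ge> 0"
    by (intro sum_nonneg) (auto simp: inversion_set_def positive_roots_def height_def intro!: sum_nonneg)
  then show ?thesis by (simp add: atomic_length_def)
qed

lemma reflection_involution: "reflection \<alpha> (reflection \<alpha> x) = x"
  by (cases "\<alpha> = 0") (simp_all add: reflection_def algebra_simps)

lemma linear_reflection: "linear (reflection \<alpha>)"
  by (rule linearI)
    (simp_all add: reflection_def algebra_simps add_divide_distrib)

lemma word_product_simps [simp]:
  "word_product [] = id" "word_product (\<delta> # \<delta>s) = reflection \<delta> \<circ> word_product \<delta>s"
  by (simp_all add: word_product_def)

lemma word_product_append: "word_product (\<delta>s @ \<epsilon>s) = word_product \<delta>s \<circ> word_product \<epsilon>s"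
  by (induction \<delta>s) (simp_all add: comp_assoc)

lemma word_product_rev: "word_product \<delta>s \<circ> word_product (rev \<delta>s) = id"
  by (induction \<delta>s) (auto simp: word_product_append fun_eq_iff reflection_involution)

lemma linear_word_product: "linear (word_product \<delta>s)"
proof (induction \<delta>s)
  case Nil
  show ?case using linear_id by (simp add: id_def)
next
  case (Cons \<delta> \<delta>s)
  then show ?case unfolding word_product_simps by (rule linear_compose[OF _ linear_reflection])
qed

lemma inv_word_product: "inv (word_product \<delta>s) = word_product (rev \<delta>s)"
  using word_product_rev[of \<delta>s] word_product_rev[of "rev \<delta>s"]
  by (intro inv_unique_comp) simp_all

lemma inv_in_weyl_group: "w \<in> weyl_group \<Delta> \<Longrightarrow> bij w \<and> inv w \<in> weyl_group \<Delta>"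
proof -
  assume "w \<in> weyl_group \<Delta>"
  then obtain \<delta>s where ds: "set \<delta>s \<subseteq> \<Delta>" "w = word_product \<delta>s" by (auto simp: weyl_group_def)
  have "bij w"
    using ds word_product_rev[of \<delta>s] word_product_rev[of "rev \<delta>s"] by (intro o_bij) simp_all
  moreover have "inv w \<in> weyl_group \<Delta>"
    using ds by (auto simp: weyl_group_def inv_word_product intro!: exI[of _ "rev \<delta>s"])
  ultimately show ?thesis ..
qed

lemma (in root_system) word_product_root:
  "\<lbrakk>set \<delta>s \<subseteq> \<Phi>; \<alpha> \<in> \<Phi>\<rbrakk> \<Longrightarrow> word_product \<delta>s \<alpha> \<in> \<Phi>"
  by (induction \<delta>s) (auto intro: reflection_root)

lemma (in root_system) finite_weyl_group:
  assumes "\<Delta> \<subseteq> \<Phi>"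
  shows "finite (weyl_group \<Delta>)"
proof (rule inj_on_finite[where f = "\<lambda>w. restrict w \<Phi>" and B = "\<Phi> \<rightarrow>\<^sub>E \<Phi>"])
  show "inj_on (\<lambda>w. restrict w \<Phi>) (weyl_group \<Delta>)"
  proof (rule inj_onI)
    fix v w assume vw: "v \<in> weyl_group \<Delta>" "w \<in> weyl_group \<Delta>" "restrict v \<Phi> = restrict w \<Phi>"
    have "v x = w x" for x
    proof (rule linear_eq_on[where f = v and g = w and x = x and B = \<Phi>])
      show "linear v" "linear w" using vw linear_word_product by (auto simp: weyl_group_def)
      show "x \<in> span \<Phi>" by (simp add: span_roots)
      show "v b = w b" if "b \<in> \<Phi>" for b using vw(3) that by (metis restrict_apply')
    qed
    then show "v = w" by (rule ext)
  qed
  show "(\<lambda>w. restrict w \<Phi>) ` weyl_group \<Delta> \<subseteq> \<Phi> \<rightarrow>\<^sub>E \<Phi>"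
    using assms by (fastforce simp: weyl_group_def intro: word_product_root)
  show "finite (\<Phi> \<rightarrow>\<^sub>E \<Phi>)" by (intro finite_PiE finite_roots)
qed

lemma (in root_system) longest_element_exists:
  assumes "\<Delta> \<subseteq> \<Phi>"
  shows "\<exists>w0. longest_element \<Delta> w0"
proof -
  have "id \<in> weyl_group \<Delta>" by (auto simp: weyl_group_def intro!: exI[of _ "[]"])
  then have "Max (coxeter_length \<Delta> ` weyl_group \<Delta>) \<in> coxeter_length \<Delta> ` weyl_group \<Delta>"
    using finite_weyl_group[OF assms] by (intro Max_in) auto
  then obtain w0 where "w0 \<in> weyl_group \<Delta>"
    "coxeter_length \<Delta> w0 = Max (coxeter_length \<Delta> ` weyl_group \<Delta>)"
    by (metis imageE)
  then show ?thesis
    using finite_weyl_group[OF assms] by (auto simp: longest_element_def intro!: exI[of _ w0])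
qed

end

theory Submission
  imports Defs
begin

text \<open>
  With \<open>\<rho>\<close> half the sum of the positive roots, the inversion set of \<open>w\<close> sums to \<open>\<rho> - w \<rho>\<close>, so the atomic
  length of \<open>w\<close> is the height of \<open>\<rho> - w \<rho>\<close>. Applying \<open>s\<^sub>i\<close> on the left changes it by the pairing of
  \<open>w \<rho>\<close> with the coroot of \<open>\<alpha>\<^sub>i\<close>: values are explored by playing Mozes' numbers game on
  the Dynkin diagram, starting from the all-ones vector. Multiplying by the longest element on the right turns
  the value \<open>k\<close> into \<open>M - k\<close>, where \<open>M\<close> is the maximum, so only \<open>k \<le> M / 2\<close> matters. In
  the classical families this range is already covered by the parabolic subgroup of rank one less,
  because \<open>M\<close> grows only cubically in the rank; the small ranks and the exceptional types are settled by
  explicit plays. In rank two the value \<open>2\<close> is missing: \<open>\<rho> - w \<rho> = \<alpha> + \<beta>\<close> with \<open>\<alpha>, \<beta>\<close> simple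
  would force \<open>\<alpha> \<bullet> \<beta> = 0\<close>, by comparing norms.

  The Dynkin diagram is determined by looking at a longest path \<open>P\<close> of simple bonds. Contracting
  a subpath to a vertex and Bessel's inequality restrict what can be attached to \<open>P\<close>, and the
  remaining unwanted diagrams contain an affine diagram, whose null vector contradicts linear independence.
\<close>

section \<open>Root systems with a base\<close>

text \<open>Passing to rank one less works only if the maximum there is at least half of the new
  one. This just fails in small ranks: B3 and C3 reach 22 where 25 is wanted, D4 reaches 28 where 30
  is wanted, and A2 misses the value 2. So the recursions start at A3, B4, C4 and D5, and explicit
  plays supply what lies below. The deleted vertex must leave a diagram of the same family;
  therefore double bonds and branches are placed at the beginning of the numbering and the deleted
  vertex at the end. The maxima come from linear algebra: the coordinates of the sum of the positive
  roots solve a system with the Cartan matrix, so neither the roots nor a longest element is ever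
  listed. A classification up to isomorphism is not the aim. It suffices to enumerate \<Delta> in
  some order that realises one of the matrices treated. G2 needs no play, since a triple bond admits
  no further neighbour and so occurs only in rank two.\<close>

lemma reflection_isometry: "reflection \<delta> u \<bullet> reflection \<delta> v = u \<bullet> v"
  by (cases "\<delta> = 0") (simp_all add: reflection_def inner_simps inner_commute field_simps)

lemma reflection_conj:
  "reflection (reflection \<delta> \<beta>) x = reflection \<delta> (reflection \<beta> (reflection \<delta> x))"
proof -
  have "reflection (reflection \<delta> \<beta>) (reflection \<delta> y) = reflection \<delta> (reflection \<beta> y)" for y
    unfolding reflection_def[of "reflection \<delta> \<beta>"] reflection_def[of \<beta>] reflection_isometry
    by (simp add: linear_diff[OF linear_reflection] linear_scale[OF linear_reflection])
  from this[of "reflection \<delta> x"] show ?thesis by (simp add: reflection_involution)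
qed

locale based_root_system = root_system \<Phi> for \<Phi> :: "'a::euclidean_space set" +
  fixes \<Delta> :: "'a set"
  assumes simple: "simple_roots \<Phi> \<Delta>"
begin

abbreviation "pos \<equiv> positive_roots \<Phi> \<Delta>"
abbreviation "neg \<equiv> negative_roots \<Phi> \<Delta>"
abbreviation "rep \<equiv> representation \<Delta>"

section \<open>Coordinates in the base\<close>

lemma simple_subset: "\<Delta> \<subseteq> \<Phi>"
  and indep: "independent \<Delta>"
  and span_simple: "span \<Delta> = UNIV"
  using simple by (auto simp: simple_roots_def)

lemma finite_simple: "finite \<Delta>"
  using finite_subset[OF simple_subset finite_roots] .

lemma simple_nonzero: "\<delta> \<in> \<Delta> \<Longrightarrow> \<delta> \<noteq> 0"
  using simple_subset zero_not_root by auto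

lemma rep_add: "rep (u + v) \<delta> = rep u \<delta> + rep v \<delta>"
  and rep_diff: "rep (u - v) \<delta> = rep u \<delta> - rep v \<delta>"
  and rep_minus: "rep (- u) \<delta> = - rep u \<delta>"
  and rep_scale: "rep (c *\<^sub>R u) \<delta> = c * rep u \<delta>"
  using representation_add[OF indep] representation_diff[OF indep] representation_neg[OF indep]
    representation_scale[OF indep]
  by (simp_all add: span_simple)

lemma rep_sum: "rep (sum f I) \<delta> = (\<Sum>i\<in>I. rep (f i) \<delta>)"
  using representation_sum[OF indep, of I f] by (simp add: span_simple)

lemma rep_simple: "\<delta> \<in> \<Delta> \<Longrightarrow> rep \<delta> \<epsilon> = (if \<epsilon> = \<delta> then 1 else 0)"
  using representation_basis[OF indep] by simp

lemma rep_expand: "v = (\<Sum>\<delta>\<in>\<Delta>. rep v \<delta> *\<^sub>R \<delta>)"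
  using sum_representation_eq[OF indep, of v \<Delta>] finite_simple by (simp add: span_simple)

lemma rep_eqI: "(\<And>\<delta>. \<delta> \<in> \<Delta> \<Longrightarrow> rep u \<delta> = rep v \<delta>) \<Longrightarrow> u = v"
  using rep_expand[of u] rep_expand[of v] by (metis (mono_tags, lifting) sum.cong)

lemma rep_int: "\<alpha> \<in> \<Phi> \<Longrightarrow> \<delta> \<in> \<Delta> \<Longrightarrow> rep \<alpha> \<delta> \<in> \<int>"
  using simple by (auto simp: simple_roots_def)

lemma in_span_iff: "J \<subseteq> \<Delta> \<Longrightarrow> v \<in> span J \<longleftrightarrow> (\<forall>\<delta>\<in>\<Delta> - J. rep v \<delta> = 0)"
proof
  assume J: "J \<subseteq> \<Delta>" and v: "v \<in> span J"
  then have "rep v = representation J v"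
    by (intro representation_extend indep) auto
  then show "\<forall>\<delta>\<in>\<Delta> - J. rep v \<delta> = 0"
    using representation_ne_zero[of J v] by auto
next
  assume J: "J \<subseteq> \<Delta>" and v: "\<forall>\<delta>\<in>\<Delta> - J. rep v \<delta> = 0"
  have "v = (\<Sum>\<delta>\<in>J. rep v \<delta> *\<^sub>R \<delta>)"
    using rep_expand[of v] sum.mono_neutral_right[OF finite_simple J, of "\<lambda>\<delta>. rep v \<delta> *\<^sub>R \<delta>"] v by simp
  also have "\<dots> \<in> span J" by (intro span_sum span_scale span_base)
  finally show "v \<in> span J" .
qed

section \<open>Positive roots and simple reflections\<close>

lemma uminus_root: "\<alpha> \<in> \<Phi> \<Longrightarrow> - \<alpha> \<in> \<Phi>"
  using reflection_root[of \<alpha> \<alpha>] zero_not_root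
  by (cases "\<alpha> = 0") (auto simp: reflection_def scaleR_2)

lemma pos_root: "\<alpha> \<in> pos \<Longrightarrow> \<alpha> \<in> \<Phi>"
  and pos_rep: "\<alpha> \<in> pos \<Longrightarrow> \<delta> \<in> \<Delta> \<Longrightarrow> rep \<alpha> \<delta> \<ge> 0"
  by (auto simp: positive_roots_def)

lemma finite_pos: "finite pos"
  using finite_roots by (simp add: positive_roots_def)

lemma neg_iff: "\<alpha> \<in> neg \<longleftrightarrow> - \<alpha> \<in> pos"
  by (force simp: negative_roots_def)

lemma neg_rep: "\<alpha> \<in> neg \<Longrightarrow> \<delta> \<in> \<Delta> \<Longrightarrow> rep \<alpha> \<delta> \<le> 0"
  using pos_rep[of "- \<alpha>" \<delta>] by (simp add: neg_iff rep_minus)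

lemma root_cases: "\<alpha> \<in> \<Phi> \<Longrightarrow> \<alpha> \<in> pos \<or> \<alpha> \<in> neg"
  using simple uminus_root[of \<alpha>] by (auto simp: simple_roots_def neg_iff positive_roots_def rep_minus)

lemma pos_not_neg: "\<alpha> \<in> pos \<Longrightarrow> \<alpha> \<notin> neg"
proof
  assume a: "\<alpha> \<in> pos" "\<alpha> \<in> neg"
  then have "rep \<alpha> \<delta> = rep 0 \<delta>" if "\<delta> \<in> \<Delta>" for \<delta>
    using pos_rep[OF a(1) that] neg_rep[OF a(2) that] by (simp add: representation_zero)
  then have "\<alpha> = 0" by (rule rep_eqI)
  then show False using a pos_root zero_not_root by auto
qed

lemma neg_not_pos_iff: "\<alpha> \<in> \<Phi> \<Longrightarrow> \<alpha> \<in> neg \<longleftrightarrow> \<alpha> \<notin> pos"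
  using root_cases pos_not_neg by blast

lemma posI: "\<alpha> \<in> \<Phi> \<Longrightarrow> \<delta> \<in> \<Delta> \<Longrightarrow> rep \<alpha> \<delta> > 0 \<Longrightarrow> \<alpha> \<in> pos"
  using root_cases[of \<alpha>] neg_rep[of \<alpha> \<delta>] by force

lemma simple_pos: "\<delta> \<in> \<Delta> \<Longrightarrow> \<delta> \<in> pos"
  using simple_subset by (auto simp: positive_roots_def rep_simple)

lemma rep_reflection: "\<delta> \<in> \<Delta> \<Longrightarrow> rep (reflection \<delta> v) \<epsilon> =
    (if \<epsilon> = \<delta> then rep v \<epsilon> - 2 * (v \<bullet> \<delta>) / (\<delta> \<bullet> \<delta>) else rep v \<epsilon>)"
  by (simp add: reflection_def rep_diff rep_scale rep_simple)

lemma reflection_self: "reflection \<delta> \<delta> = - \<delta>"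
  by (cases "\<delta> = 0") (simp_all add: reflection_def scaleR_2)

text \<open>This is where reducedness enters: a root supported on \<delta> alone is a multiple of
  \<delta>, hence \<delta> or its negative, and positivity picks the sign.\<close>

lemma pos_eq_simpleI:
  assumes "\<alpha> \<in> pos" "\<delta> \<in> \<Delta>" "\<And>\<epsilon>. \<epsilon> \<in> \<Delta> \<Longrightarrow> \<epsilon> \<noteq> \<delta> \<Longrightarrow> rep \<alpha> \<epsilon> = 0"
  shows "\<alpha> = \<delta>"
proof -
  have "\<alpha> = rep \<alpha> \<delta> *\<^sub>R \<delta>"
    by (rule rep_eqI) (use assms in \<open>auto simp: rep_scale rep_simple\<close>)
  then have "rep \<alpha> \<delta> = 1 \<or> rep \<alpha> \<delta> = -1"
    using reduced[of \<delta> "rep \<alpha> \<delta>"] assms simple_subset pos_root by auto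
  then show ?thesis using pos_rep[OF assms(1,2)] \<open>\<alpha> = _\<close> by auto
qed

text \<open>Since \<alpha> is not \<delta>, it has a positive coordinate at another simple root. The
  reflection leaves that coordinate alone, and one positive coordinate decides the sign of a
  root.\<close>

lemma reflection_pos:
  assumes "\<delta> \<in> \<Delta>" "\<alpha> \<in> pos" "\<alpha> \<noteq> \<delta>"
  shows "reflection \<delta> \<alpha> \<in> pos" "reflection \<delta> \<alpha> \<noteq> \<delta>"
proof -
  obtain \<epsilon> where e: "\<epsilon> \<in> \<Delta>" "\<epsilon> \<noteq> \<delta>" "rep \<alpha> \<epsilon> > 0"
    using pos_eq_simpleI[OF assms(2,1)] assms(3) pos_rep[OF assms(2)] by force
  then have "rep (reflection \<delta> \<alpha>) \<epsilon> > 0" using assms by (simp add: rep_reflection)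
  then show "reflection \<delta> \<alpha> \<in> pos"
    using e assms simple_subset pos_root by (intro posI reflection_root) auto
  show "reflection \<delta> \<alpha> \<noteq> \<delta>"
    using reflection_involution[of \<delta> \<alpha>] reflection_self[of \<delta>] assms pos_not_neg[OF assms(2)] simple_pos
    by (auto simp: neg_iff)
qed

text \<open>The reflection permutes \<open>A - {\<delta>}\<close>. A general \<open>A\<close> serves
  both \<open>pos\<close> and \<open>pos \<inter> span J\<close>.\<close>

lemma reflection_image_pos:
  assumes "\<delta> \<in> \<Delta>" "A \<subseteq> pos" "\<And>\<alpha>. \<alpha> \<in> A \<Longrightarrow> \<alpha> \<noteq> \<delta> \<Longrightarrow> reflection \<delta> \<alpha> \<in> A"
  shows "(\<Sum>\<alpha>\<in>A - {\<delta>}. reflection \<delta> \<alpha>) = \<Sum>(A - {\<delta>})"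
  by (rule sum.reindex_bij_witness[of _ "reflection \<delta>" "reflection \<delta>"])
    (use assms reflection_pos in \<open>auto simp: reflection_involution\<close>)

text \<open>Otherwise the reflection in \<alpha> would give \<beta> a negative coordinate at
  \<alpha>, although it keeps \<beta> positive.\<close>

lemma simple_obtuse:
  assumes "\<alpha> \<in> \<Delta>" "\<beta> \<in> \<Delta>" "\<alpha> \<noteq> \<beta>"
  shows "\<alpha> \<bullet> \<beta> \<le> 0"
proof (rule ccontr)
  assume "\<not> \<alpha> \<bullet> \<beta> \<le> 0"
  then have "2 * (\<beta> \<bullet> \<alpha>) / (\<alpha> \<bullet> \<alpha>) > 0"
    using simple_nonzero[OF assms(1)] by (simp add: inner_commute)
  then have "rep (reflection \<alpha> \<beta>) \<alpha> < 0"
    using assms by (simp add: rep_reflection rep_simple)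
  then show False
    using pos_rep[OF reflection_pos(1)[OF assms(1) simple_pos[OF assms(2)]] assms(1)] assms(3) by auto
qed

lemma root_decrease:
  assumes "\<beta> \<in> pos" "\<beta> \<notin> \<Delta>"
  shows "\<exists>\<delta>\<in>\<Delta>. \<beta> \<bullet> \<delta> > 0"
proof (rule ccontr)
  assume "\<not> (\<exists>\<delta>\<in>\<Delta>. \<beta> \<bullet> \<delta> > 0)"
  then have "\<beta> \<bullet> (\<Sum>\<delta>\<in>\<Delta>. rep \<beta> \<delta> *\<^sub>R \<delta>) \<le> 0"
    by (auto simp: inner_sum_right intro!: sum_nonpos mult_nonneg_nonpos pos_rep assms)
  then have "\<beta> \<bullet> \<beta> \<le> 0" using rep_expand[of \<beta>] by simp
  then have "\<beta> = 0" using inner_ge_zero[of \<beta>] by (metis antisym inner_eq_zero_iff)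
  then show False using assms pos_root zero_not_root by auto
qed

text \<open>The height as a linear functional on the whole space: it has to be applied to \<rho> and
  its images, whose coordinates may be half-integers.\<close>

definition H :: "'a \<Rightarrow> real" where
  "H v = (\<Sum>\<delta>\<in>\<Delta>. rep v \<delta>)"

lemma H_diff: "H (u - v) = H u - H v"
  and H_scale: "H (c *\<^sub>R u) = c * H u"
  by (simp_all add: H_def rep_diff rep_scale sum.distrib sum_subtractf sum_distrib_left)

lemma H_sum: "H (sum f I) = (\<Sum>i\<in>I. H (f i))"
  unfolding H_def rep_sum by (rule sum.swap)

lemma H_simple: "\<delta> \<in> \<Delta> \<Longrightarrow> H \<delta> = 1"
  using finite_simple by (simp add: H_def rep_simple)

lemma H_int: "\<alpha> \<in> \<Phi> \<Longrightarrow> H \<alpha> \<in> \<int>"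
  unfolding H_def by (intro Ints_sum rep_int) auto

lemma H_pos: "\<alpha> \<in> pos \<Longrightarrow> H \<alpha> \<ge> 1"
proof -
  assume a: "\<alpha> \<in> pos"
  have ge: "H \<alpha> \<ge> 0" unfolding H_def by (intro sum_nonneg pos_rep a)
  have "H \<alpha> \<noteq> 0"
  proof
    assume "H \<alpha> = 0"
    then have "\<forall>\<delta>\<in>\<Delta>. rep \<alpha> \<delta> = 0"
      unfolding H_def using sum_nonneg_eq_0_iff[OF finite_simple pos_rep[OF a]] by simp
    then have "\<alpha> = 0" by (intro rep_eqI) (auto simp: representation_zero)
    then show False using a pos_root zero_not_root by auto
  qed
  moreover obtain k :: int where "H \<alpha> = of_int k" using H_int[OF pos_root[OF a]] by (auto elim: Ints_cases)
  ultimately show ?thesis using ge by auto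
qed

section \<open>The Weyl vector\<close>

definition \<rho> :: 'a where "\<rho> = (1/2) *\<^sub>R \<Sum>pos"

text \<open>The reflection negates \<delta> and permutes the rest of \<open>A\<close>, so it lowers
  the sum by \<open>2 *\<^sub>R \<delta>\<close>. For \<open>pos\<close> this is the basic property
  of \<rho>; for \<open>pos \<inter> span J\<close> it yields the maxima in
  \<open>L_longest_eq\<close>.\<close>

lemma reflection_simple_root_sum:
  assumes "\<delta> \<in> A" "\<delta> \<in> \<Delta>" "A \<subseteq> pos" "\<And>\<alpha>. \<alpha> \<in> A \<Longrightarrow> \<alpha> \<noteq> \<delta> \<Longrightarrow> reflection \<delta> \<alpha> \<in> A"
  shows "2 * (\<Sum>A \<bullet> \<delta>) / (\<delta> \<bullet> \<delta>) = 2"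
proof -
  have fin: "finite A" using finite_subset[OF assms(3) finite_pos] .
  have "reflection \<delta> (\<Sum>A) = (\<Sum>\<alpha>\<in>A. reflection \<delta> \<alpha>)"
    using linear_sum[OF linear_reflection, of \<delta> "\<lambda>x. x" A] by simp
  also have "\<dots> = - \<delta> + \<Sum>(A - {\<delta>})"
    using sum.remove[OF fin assms(1), of "reflection \<delta>"] reflection_image_pos[OF assms(2-4)]
    by (simp add: reflection_self)
  also have "\<dots> = \<Sum>A - 2 *\<^sub>R \<delta>"
    using sum.remove[OF fin assms(1), of "\<lambda>x. x"] by (simp add: scaleR_2)
  finally have "(2 * (\<Sum>A \<bullet> \<delta>) / (\<delta> \<bullet> \<delta>)) *\<^sub>R \<delta> = 2 *\<^sub>R \<delta>"
    by (simp add: reflection_def)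
  then show ?thesis using simple_nonzero[OF assms(2)] by (simp add: scaleR_right_imp_eq)
qed

lemma rho_coroot: "\<delta> \<in> \<Delta> \<Longrightarrow> 2 * (\<rho> \<bullet> \<delta>) / (\<delta> \<bullet> \<delta>) = 1"
proof -
  assume d: "\<delta> \<in> \<Delta>"
  have "2 * (\<Sum>pos \<bullet> \<delta>) / (\<delta> \<bullet> \<delta>) = 2"
    using reflection_simple_root_sum[of \<delta> pos] d simple_pos reflection_pos(1) by blast
  then show ?thesis unfolding \<rho>_def inner_scaleR_left by linarith
qed

lemma reflection_rho: "\<delta> \<in> \<Delta> \<Longrightarrow> reflection \<delta> \<rho> = \<rho> - \<delta>"
  unfolding reflection_def by (simp only: rho_coroot scaleR_one)

section \<open>The Weyl group and sums over inversion sets\<close>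

lemma word_in_weyl: "set ds \<subseteq> J \<Longrightarrow> word_product ds \<in> weyl_group J"
  by (auto simp: weyl_group_def)

lemma weyl_root: "w \<in> weyl_group \<Delta> \<Longrightarrow> \<alpha> \<in> \<Phi> \<Longrightarrow> w \<alpha> \<in> \<Phi>"
  using word_product_root simple_subset by (auto simp: weyl_group_def)

lemma weyl_mono: "J \<subseteq> K \<Longrightarrow> weyl_group J \<subseteq> weyl_group K"
  by (auto simp: weyl_group_def)

lemma weyl_comp: "v \<in> weyl_group J \<Longrightarrow> w \<in> weyl_group J \<Longrightarrow> v \<circ> w \<in> weyl_group J"
proof -
  assume "v \<in> weyl_group J" "w \<in> weyl_group J"
  then obtain ds es where "set ds \<subseteq> J" "v = word_product ds" "set es \<subseteq> J" "w = word_product es"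
    by (auto simp: weyl_group_def)
  then show ?thesis
    using word_in_weyl[of "ds @ es" J] by (simp add: word_product_append)
qed

lemma reflection_weyl: "\<delta> \<in> J \<Longrightarrow> w \<in> weyl_group J \<Longrightarrow> reflection \<delta> \<circ> w \<in> weyl_group J"
  using weyl_comp[OF word_in_weyl[of "[\<delta>]" J]] by simp

lemma id_weyl: "id \<in> weyl_group J"
  using word_in_weyl[of "[]" J] by simp

lemma weyl_inv: "w \<in> weyl_group J \<Longrightarrow> inv w \<in> weyl_group J"
  and weyl_bij: "w \<in> weyl_group J \<Longrightarrow> bij w"
  using inv_in_weyl_group by auto

lemma weyl_linear: "w \<in> weyl_group J \<Longrightarrow> linear w"
  by (auto simp: weyl_group_def linear_word_product)

lemma weyl_isometry: "w \<in> weyl_group J \<Longrightarrow> w u \<bullet> w v = u \<bullet> v"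
proof -
  assume "w \<in> weyl_group J"
  then obtain ds where "w = word_product ds" by (auto simp: weyl_group_def)
  moreover have "word_product ds u \<bullet> word_product ds v = u \<bullet> v"
    by (induction ds) (simp_all add: reflection_isometry)
  ultimately show ?thesis by simp
qed

lemma inv_reflection_comp: "w \<in> weyl_group J \<Longrightarrow> inv (reflection \<delta> \<circ> w) = inv w \<circ> reflection \<delta>"
proof -
  assume w: "w \<in> weyl_group J"
  have "bij (reflection \<delta>)" by (rule o_bij[of "reflection \<delta>"]) (auto simp: fun_eq_iff reflection_involution)
  moreover have "inv (reflection \<delta>) = reflection \<delta>"
    by (rule inv_unique_comp) (auto simp: fun_eq_iff reflection_involution)
  ultimately show ?thesis using o_inv_distrib[OF _ weyl_bij[OF w]] by metis
qed

lemma inversion_iff: "\<alpha> \<in> inversion_set \<Phi> \<Delta> w \<longleftrightarrow> \<alpha> \<in> pos \<and> inv w \<alpha> \<in> neg"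
  by (simp add: inversion_set_def)

lemma finite_inversion: "finite (inversion_set \<Phi> \<Delta> w)"
  using finite_pos by (simp add: inversion_set_def)

lemma sum_inversion_set:
  "w \<in> weyl_group \<Delta> \<Longrightarrow> \<Sum>(inversion_set \<Phi> \<Delta> w) = \<rho> - w \<rho>"
proof -
  have "\<Sum>(inversion_set \<Phi> \<Delta> (word_product ds)) = \<rho> - word_product ds \<rho>" if "set ds \<subseteq> \<Delta>" for ds
    using that
  proof (induction ds)
    case Nil
    have "inversion_set \<Phi> \<Delta> id = {}" using pos_not_neg by (auto simp: inversion_iff)
    then show ?case by (simp only: word_product_simps sum.empty) simp
  next
    case (Cons \<delta> ds)
    define w where "w = word_product ds"
    define N where "N = inversion_set \<Phi> \<Delta> w"
    define N' where "N' = inversion_set \<Phi> \<Delta> (reflection \<delta> \<circ> w)"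
    have d: "\<delta> \<in> \<Delta>" and w: "w \<in> weyl_group \<Delta>"
      using Cons word_in_weyl by (auto simp: w_def)
    have iw: "inv w \<in> weyl_group \<Delta>" using weyl_inv[OF w] .
    have inv: "inv (reflection \<delta> \<circ> w) \<alpha> = inv w (reflection \<delta> \<alpha>)" for \<alpha>
      using inv_reflection_comp[OF w] by simp
    \<comment> \<open>Away from \<delta> the inversions of
      \<open>reflection \<delta> \<circ> w\<close> are the reflected inversions of \<open>w\<close>,
      while \<delta> itself changes membership. Hence
      \<open>\<Sum>N' = \<delta> + reflection \<delta> (\<Sum>N)\<close>, and the right-hand side of
      the claim obeys the same rule because
      \<open>reflection \<delta> \<rho> = \<rho> - \<delta>\<close>.\<close>
    have mem: "\<alpha> \<in> N' \<longleftrightarrow> reflection \<delta> \<alpha> \<in> N" if "\<alpha> \<noteq> \<delta>" "\<alpha> \<in> pos" for \<alpha>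
      using that reflection_pos[OF d] by (simp add: N_def N'_def inversion_iff inv)
    have dmem: "\<delta> \<in> N' \<longleftrightarrow> \<delta> \<notin> N"
    proof -
      have "inv w (- \<delta>) = - inv w \<delta>" using linear_neg[OF weyl_linear[OF iw]] .
      then show ?thesis
        using neg_not_pos_iff[OF weyl_root[OF iw, of \<delta>]] d simple_pos[OF d] simple_subset
        by (auto simp: N_def N'_def inversion_iff inv reflection_self neg_iff)
    qed
    have sub: "N \<subseteq> pos" "N' \<subseteq> pos" by (auto simp: N_def N'_def inversion_iff)
    have "\<Sum>(N' - {\<delta>}) = (\<Sum>\<alpha>\<in>N - {\<delta>}. reflection \<delta> \<alpha>)"
    proof (rule sum.reindex_bij_witness[of _ "reflection \<delta>" "reflection \<delta>"])
      fix \<alpha> assume "\<alpha> \<in> N' - {\<delta>}"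
      then show "reflection \<delta> \<alpha> \<in> N - {\<delta>}"
        using mem reflection_pos[OF d] sub by auto
    next
      fix \<alpha> assume a: "\<alpha> \<in> N - {\<delta>}"
      then have "reflection \<delta> \<alpha> \<in> pos" "reflection \<delta> \<alpha> \<noteq> \<delta>" using reflection_pos[OF d] sub by auto
      then show "reflection \<delta> \<alpha> \<in> N' - {\<delta>}"
        using mem[of "reflection \<delta> \<alpha>"] a by (auto simp: reflection_involution)
    qed (auto simp: reflection_involution)
    also have "\<dots> = reflection \<delta> (\<Sum>(N - {\<delta>}))"
      using linear_sum[OF linear_reflection, of \<delta> "\<lambda>x. x"] by simp
    finally have eq: "\<Sum>(N' - {\<delta>}) = reflection \<delta> (\<Sum>(N - {\<delta>}))" .
    have fin: "finite N" "finite N'" by (auto simp: N_def N'_def finite_inversion)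
    have "\<Sum>N' = \<delta> + reflection \<delta> (\<Sum>N)"
    proof (cases "\<delta> \<in> N")
      case True
      then have "\<Sum>N = \<delta> + \<Sum>(N - {\<delta>})" "\<delta> \<notin> N'"
        using sum.remove[OF fin(1)] dmem by auto
      then show ?thesis
        using eq linear_add[OF linear_reflection, of \<delta> \<delta>] by (simp add: reflection_self)
    next
      case False
      then have "\<Sum>N' = \<delta> + \<Sum>(N' - {\<delta>})" using sum.remove[OF fin(2)] dmem by auto
      then show ?thesis using False eq by simp
    qed
    also have "\<Sum>N = \<rho> - w \<rho>" using Cons by (simp add: N_def w_def)
    also have "\<delta> + reflection \<delta> (\<rho> - w \<rho>) = \<rho> - reflection \<delta> (w \<rho>)"
      unfolding linear_diff[OF linear_reflection, of \<delta> \<rho>] reflection_rho[OF d] by simp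
    finally show ?case unfolding N'_def w_def word_product_simps by (simp only: comp_def)
  qed
  then show "w \<in> weyl_group \<Delta> \<Longrightarrow> ?thesis" by (auto simp: weyl_group_def)
qed

abbreviation "L \<equiv> atomic_length \<Phi> \<Delta>"

lemma L_eq_sum: "real (L w) = (\<Sum>\<alpha>\<in>inversion_set \<Phi> \<Delta> w. H \<alpha>)"
proof -
  have "real (L w) = real_of_int (\<Sum>\<alpha>\<in>inversion_set \<Phi> \<Delta> w. height \<Delta> \<alpha>)"
    unfolding of_nat_atomic_length[symmetric] by simp
  also have "\<dots> = (\<Sum>\<alpha>\<in>inversion_set \<Phi> \<Delta> w. H \<alpha>)"
    unfolding of_int_sum H_def
    by (intro sum.cong refl of_int_height[OF simple] pos_root) (simp add: inversion_iff)
  finally show ?thesis .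
qed

lemma L_eq: "w \<in> weyl_group \<Delta> \<Longrightarrow> real (L w) = H (\<rho> - w \<rho>)"
  using L_eq_sum H_sum[of "\<lambda>x. x"] sum_inversion_set by metis

lemma L_reflection:
  assumes "w \<in> weyl_group \<Delta>" "\<delta> \<in> \<Delta>"
  shows "real (L (reflection \<delta> \<circ> w)) = real (L w) + 2 * (w \<rho> \<bullet> \<delta>) / (\<delta> \<bullet> \<delta>)"
  using L_eq[OF assms(1)] L_eq[OF reflection_weyl[OF assms(2,1)]] H_simple[OF assms(2)]
  by (simp add: reflection_def H_diff H_scale)


section \<open>Exchange, longest elements and parabolic subgroups\<close>

lemma exchange:
  assumes "set ds \<subseteq> J" "J \<subseteq> \<Delta>" "\<beta> \<in> pos" "inv (word_product ds) \<beta> \<in> neg"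
  shows "\<exists>es. set es \<subseteq> J \<and> Suc (length es) = length ds \<and> reflection \<beta> \<circ> word_product ds = word_product es"
  using assms(1,3,4)
proof (induction ds arbitrary: \<beta>)
  case Nil
  then show ?case using pos_not_neg by auto
next
  case (Cons d ds)
  have dJ: "d \<in> J" "set ds \<subseteq> J" and d: "d \<in> \<Delta>" using Cons assms(2) by auto
  show ?case
  \<comment> \<open>As the word is read, \<beta> is reflected letter by letter. A positive root
    turns negative only at a letter equal to it; that letter is deleted, and conjugation carries the
    cancellation back to the front.\<close>
  proof (cases "\<beta> = d")
    case True
    then show ?thesis using dJ by (auto simp: fun_eq_iff reflection_involution intro!: exI[of _ ds])
  next
    case False
    let ?b = "reflection d \<beta>"
    have "?b \<in> pos" using reflection_pos[OF d Cons.prems(2) False] by simp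
    moreover have "inv (word_product ds) ?b \<in> neg"
      using Cons.prems(3) unfolding word_product_simps inv_reflection_comp[OF word_in_weyl[OF dJ(2)]]
      by simp
    ultimately obtain es where es: "set es \<subseteq> J" "Suc (length es) = length ds"
      "reflection ?b \<circ> word_product ds = word_product es"
      using Cons.IH dJ by blast
    have "reflection \<beta> (reflection d x) = reflection d (reflection ?b x)" for x
      using reflection_conj[of d \<beta> x] by (simp add: reflection_involution)
    then have "reflection \<beta> \<circ> word_product (d # ds) = word_product (d # es)"
      unfolding word_product_simps es(3)[symmetric] by (simp add: fun_eq_iff)
    moreover have "set (d # es) \<subseteq> J" "Suc (length (d # es)) = length (d # ds)" using es dJ by auto
    ultimately show ?thesis by blast
  qed
qed

text \<open>Otherwise \<delta> is an inversion of \<open>reflection \<delta> \<circ> w\<close>.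
  Exchange then deletes a letter from a shortest word of that element and leaves a word for
  \<open>w\<close>, which would be strictly shorter.\<close>

lemma longest_inv_neg:
  assumes J: "J \<subseteq> \<Delta>" and w: "longest_element J w" and d: "\<delta> \<in> J"
  shows "inv w \<delta> \<in> neg"
proof (rule ccontr)
  assume n: "inv w \<delta> \<notin> neg"
  have wJ: "w \<in> weyl_group J" using w by (simp add: longest_element_def)
  then have iw: "inv w \<in> weyl_group \<Delta>" using weyl_inv weyl_mono[OF J] by blast
  let ?v = "reflection \<delta> \<circ> w"
  have dD: "\<delta> \<in> \<Delta>" using d J by auto
  have vJ: "?v \<in> weyl_group J" using reflection_weyl[OF d wJ] .
  have ex: "\<exists>k ds. set ds \<subseteq> J \<and> length ds = k \<and> word_product ds = ?v"
    using vJ by (auto simp: weyl_group_def)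
  from LeastI_ex[OF this] obtain ds where ds: "set ds \<subseteq> J" "length ds = coxeter_length J ?v" "word_product ds = ?v"
    unfolding coxeter_length_def by blast
  have "inv ?v \<delta> = - inv w \<delta>"
    using inv_reflection_comp[OF wJ] linear_neg[OF weyl_linear[OF iw]] by (simp add: reflection_self)
  moreover have "inv w \<delta> \<in> pos"
    using root_cases[OF weyl_root[OF iw]] n dD simple_subset by blast
  ultimately have "inv ?v \<delta> \<in> neg" by (simp add: neg_iff)
  then obtain es where es: "set es \<subseteq> J" "Suc (length es) = length ds" "reflection \<delta> \<circ> ?v = word_product es"
    using exchange[OF ds(1) J simple_pos[OF dD]] ds(3) by auto
  have "word_product es = w" unfolding es(3)[symmetric] by (simp add: fun_eq_iff reflection_involution)
  then have "coxeter_length J w \<le> length es"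
    unfolding coxeter_length_def using es by (intro Least_le) auto
  moreover have "coxeter_length J ?v \<le> coxeter_length J w"
    using w vJ by (simp add: longest_element_def)
  ultimately show False using es ds by simp
qed

lemma weyl_rep_outside:
  assumes "J \<subseteq> \<Delta>" "w \<in> weyl_group J" "\<delta> \<in> \<Delta> - J"
  shows "rep (w v) \<delta> = rep v \<delta>"
proof -
  have "rep (word_product ds v) \<delta> = rep v \<delta>" if "set ds \<subseteq> J" for ds
    using that
  proof (induction ds)
    case (Cons d ds)
    then show ?case using rep_reflection[of d] assms by auto
  qed simp
  then show ?thesis using assms by (auto simp: weyl_group_def)
qed

text \<open>The group of \<open>J\<close> does not move coordinates outside \<open>J\<close>. For an
  inversion they are nonnegative before and nonpositive after, so they vanish.\<close>

lemma inversion_in_span: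
  assumes "J \<subseteq> \<Delta>" "w \<in> weyl_group J"
  shows "inversion_set \<Phi> \<Delta> w \<subseteq> pos \<inter> span J"
proof
  fix \<alpha> assume a: "\<alpha> \<in> inversion_set \<Phi> \<Delta> w"
  have "rep \<alpha> \<delta> = 0" if d: "\<delta> \<in> \<Delta> - J" for \<delta>
    using a d weyl_rep_outside[OF assms(1) weyl_inv[OF assms(2)] d, of \<alpha>]
      pos_rep[of \<alpha> \<delta>] neg_rep[of "inv w \<alpha>" \<delta>] by (auto simp: inversion_iff)
  then show "\<alpha> \<in> pos \<inter> span J" using a in_span_iff[OF assms(1)] by (auto simp: inversion_iff)
qed

lemma longest_neg:
  assumes J: "J \<subseteq> \<Delta>" and w: "longest_element J w" and a: "\<alpha> \<in> pos \<inter> span J"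
  shows "inv w \<alpha> \<in> neg"
proof -
  have iw: "inv w \<in> weyl_group \<Delta>"
    using w weyl_inv weyl_mono[OF J] by (auto simp: longest_element_def)
  have z: "rep \<alpha> \<delta> = 0" if "\<delta> \<in> \<Delta> - J" for \<delta> using a that in_span_iff[OF J] by auto
  have "rep (inv w \<alpha>) \<epsilon> \<le> 0" if e: "\<epsilon> \<in> \<Delta>" for \<epsilon>
  proof -
    have "inv w \<alpha> = (\<Sum>\<delta>\<in>\<Delta>. rep \<alpha> \<delta> *\<^sub>R inv w \<delta>)"
      by (subst rep_expand[of \<alpha>])
        (simp only: linear_sum[OF weyl_linear[OF iw]] linear_scale[OF weyl_linear[OF iw]])
    then have "rep (inv w \<alpha>) \<epsilon> = (\<Sum>\<delta>\<in>\<Delta>. rep \<alpha> \<delta> * rep (inv w \<delta>) \<epsilon>)"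
      by (simp add: rep_sum rep_scale)
    also have "\<dots> \<le> 0"
    proof (rule sum_nonpos)
      fix \<delta> assume "\<delta> \<in> \<Delta>"
      then show "rep \<alpha> \<delta> * rep (inv w \<delta>) \<epsilon> \<le> 0"
        using z[of \<delta>] pos_rep[of \<alpha> \<delta>] neg_rep[OF longest_inv_neg[OF J w, of \<delta>] e] a
        by (cases "\<delta> \<in> J") (auto intro: mult_nonneg_nonpos)
    qed
    finally show ?thesis .
  qed
  then show ?thesis
    using weyl_root[OF iw pos_root[of \<alpha>]] a uminus_root by (auto simp: neg_iff positive_roots_def rep_minus)
qed

lemma inversion_longest:
  assumes J: "J \<subseteq> \<Delta>" and w: "longest_element J w"
  shows "inversion_set \<Phi> \<Delta> w = pos \<inter> span J"
  using inversion_in_span[OF J] w longest_neg[OF J w] by (auto simp: inversion_iff longest_element_def)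

lemma L_le_longest:
  assumes J: "J \<subseteq> \<Delta>" and w0: "longest_element J w0" and w: "w \<in> weyl_group J"
  shows "L w \<le> L w0"
proof -
  have "real (L w) \<le> real (L w0)"
    unfolding L_eq_sum inversion_longest[OF J w0]
    by (intro sum_mono2 inversion_in_span[OF J w]) (use finite_pos H_pos in \<open>force+\<close>)
  then show ?thesis by simp
qed

text \<open>The inverse of \<open>w0\<close> swaps the signs of all roots in \<open>span J\<close>,
  so the inversions of \<open>w \<circ> w0\<close> form the complement of those of \<open>w\<close>
  in \<open>pos \<inter> span J\<close>.\<close>

lemma L_longest_comp:
  assumes J: "J \<subseteq> \<Delta>" and w0: "longest_element J w0" and w: "w \<in> weyl_group J"
  shows "L (w \<circ> w0) + L w = L w0"
proof -
  let ?P = "pos \<inter> span J"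
  have w0J: "w0 \<in> weyl_group J" using w0 by (simp add: longest_element_def)
  have W: "w \<in> weyl_group \<Delta>" "w0 \<in> weyl_group \<Delta>" "inv w \<in> weyl_group \<Delta>" "inv w0 \<in> weyl_group \<Delta>"
    using w w0J weyl_mono[OF J] weyl_inv by blast+
  have neg: "inv w0 \<beta> \<in> neg \<longleftrightarrow> \<beta> \<notin> neg" if "\<beta> \<in> \<Phi>" "\<beta> \<in> span J" for \<beta>
  proof (cases "\<beta> \<in> pos")
    case True
    then show ?thesis using longest_neg[OF J w0] pos_not_neg that by auto
  next
    case False
    then have "- \<beta> \<in> pos" using root_cases[OF that(1)] by (simp add: neg_iff)
    then have "inv w0 (- \<beta>) \<in> neg" using longest_neg[OF J w0] span_neg[OF that(2)] by auto
    then have "inv w0 \<beta> \<in> pos" using linear_neg[OF weyl_linear[OF W(4)]] by (simp add: neg_iff)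
    then show ?thesis using pos_not_neg \<open>- \<beta> \<in> pos\<close> by (auto simp: neg_iff)
  qed
  have "inversion_set \<Phi> \<Delta> (w \<circ> w0) = ?P - inversion_set \<Phi> \<Delta> w"
  proof -
    have "\<alpha> \<in> inversion_set \<Phi> \<Delta> (w \<circ> w0) \<longleftrightarrow> \<alpha> \<notin> inversion_set \<Phi> \<Delta> w" if a: "\<alpha> \<in> ?P" for \<alpha>
    proof -
      have "inv (w \<circ> w0) \<alpha> = inv w0 (inv w \<alpha>)"
        using o_inv_distrib[OF weyl_bij[OF W(1)] weyl_bij[OF W(2)]] by simp
      moreover have "inv w \<alpha> \<in> \<Phi>" using weyl_root[OF W(3)] a pos_root by auto
      moreover have "inv w \<alpha> \<in> span J"
        using a weyl_rep_outside[OF J weyl_inv[OF w]] by (auto simp: in_span_iff[OF J])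
      ultimately show ?thesis using neg[of "inv w \<alpha>"] a by (simp add: inversion_iff)
    qed
    then show ?thesis using inversion_in_span[OF J weyl_comp[OF w w0J]] inversion_in_span[OF J w] by blast
  qed
  then have "real (L (w \<circ> w0)) + real (L w) = real (L w0)"
    unfolding L_eq_sum inversion_longest[OF J w0]
    using sum_diff[of ?P "inversion_set \<Phi> \<Delta> w" H] inversion_in_span[OF J w] finite_pos by auto
  then show ?thesis by linarith
qed

lemma fullI:
  assumes J: "J \<subseteq> \<Delta>" and w0: "longest_element J w0" and M: "L w0 = M"
    and half: "\<And>k. 2 * k \<le> M \<Longrightarrow> k \<in> L ` weyl_group J"
  shows "L ` weyl_group J = {0..M}"
proof
  show "L ` weyl_group J \<subseteq> {0..M}" using L_le_longest[OF J w0] M by auto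
  show "{0..M} \<subseteq> L ` weyl_group J"
  proof
    fix k assume k: "k \<in> {0..M}"
    show "k \<in> L ` weyl_group J"
    proof (cases "2 * k \<le> M")
      case False
      then have "M - k \<in> L ` weyl_group J" by (intro half) simp
      then obtain w where w: "w \<in> weyl_group J" "L w = M - k" by (metis imageE)
      then have "L (w \<circ> w0) = k" using L_longest_comp[OF J w0 w(1)] k M by auto
      then show ?thesis
        using weyl_comp[OF w(1)] w0 by (auto simp: image_iff longest_element_def)
    qed (rule half)
  qed
qed

text \<open>The positive roots in \<open>span J\<close> sum to a vector of \<open>span J\<close>
  that pairs to 2 with every simple coroot of \<open>J\<close>, and these pairings determine it. So
  \<open>x\<close> lists its coordinates.\<close>

lemma L_longest_eq:
  assumes J: "J \<subseteq> \<Delta>" and w0: "longest_element J w0"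
    and x: "\<And>\<delta>. \<delta> \<in> J \<Longrightarrow> (\<Sum>\<epsilon>\<in>J. x \<epsilon> * (2 * (\<epsilon> \<bullet> \<delta>) / (\<delta> \<bullet> \<delta>))) = 2"
  shows "real (L w0) = (\<Sum>\<delta>\<in>J. x \<delta>)"
proof -
  define \<sigma> where "\<sigma> = \<Sum>(pos \<inter> span J)"
  define \<tau> where "\<tau> = (\<Sum>\<epsilon>\<in>J. x \<epsilon> *\<^sub>R \<epsilon>)"
  have s: "2 * (\<sigma> \<bullet> \<delta>) / (\<delta> \<bullet> \<delta>) = 2" if "\<delta> \<in> J" for \<delta>
    unfolding \<sigma>_def
  proof (rule reflection_simple_root_sum)
    show "\<delta> \<in> pos \<inter> span J" "\<delta> \<in> \<Delta>" using that J simple_pos by (auto intro: span_base)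
    fix \<alpha> assume "\<alpha> \<in> pos \<inter> span J" "\<alpha> \<noteq> \<delta>"
    then show "reflection \<delta> \<alpha> \<in> pos \<inter> span J"
      using that J reflection_pos(1)[of \<delta> \<alpha>]
      by (auto simp: reflection_def intro!: span_diff span_scale intro: span_base)
  qed auto
  have t: "2 * (\<tau> \<bullet> \<delta>) / (\<delta> \<bullet> \<delta>) = 2" if "\<delta> \<in> J" for \<delta>
    using x[OF that] by (simp add: \<tau>_def inner_sum_left sum_distrib_left sum_divide_distrib mult.left_commute)
  have "orthogonal (\<sigma> - \<tau>) v" if "v \<in> span J" for v
  proof (rule orthogonal_to_span[OF that])
    fix \<delta> assume d: "\<delta> \<in> J"
    then have "\<sigma> \<bullet> \<delta> = \<delta> \<bullet> \<delta>" "\<tau> \<bullet> \<delta> = \<delta> \<bullet> \<delta>"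
      using s[OF d] t[OF d] J simple_nonzero[of \<delta>] by (auto simp: field_simps)
    then show "orthogonal (\<sigma> - \<tau>) \<delta>" by (simp add: orthogonal_def inner_diff_left)
  qed
  moreover have "\<sigma> \<in> span J" unfolding \<sigma>_def by (intro span_sum) auto
  moreover have "\<tau> \<in> span J" unfolding \<tau>_def by (intro span_sum span_scale span_base)
  ultimately have "orthogonal (\<sigma> - \<tau>) (\<sigma> - \<tau>)" using span_diff[of \<sigma> J \<tau>] by blast
  then have "\<sigma> = \<tau>" by (simp add: orthogonal_self)
  have "real (L w0) = H \<sigma>"
    unfolding L_eq_sum inversion_longest[OF J w0] \<sigma>_def by (rule H_sum[symmetric])
  also have "\<dots> = (\<Sum>\<delta>\<in>J. x \<delta>)"
    unfolding \<open>\<sigma> = \<tau>\<close> \<tau>_def H_sum H_scale using J H_simple by (intro sum.cong) auto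
  finally show ?thesis .
qed

end

section \<open>The numbers game\<close>

text \<open>
  The entry at \<open>i j\<close> is \<open>2 (\<alpha>\<^sub>i \<bullet> \<alpha>\<^sub>j) / (\<alpha>\<^sub>i \<bullet> \<alpha>\<^sub>i)\<close>. The vertices
  \<open>1, 2, \<dots>\<close> form a path and vertex \<open>0\<close> is attached to vertex \<open>k\<close> of it: \<open>k = 1\<close> gives the types A, B, C
  (depending on \<open>p, q\<close>), \<open>k = 2\<close> gives D, and \<open>k = 3\<close> gives E. Removing the last vertex preserves
  the shape.
\<close>

definition cartan :: "nat \<Rightarrow> int \<Rightarrow> int \<Rightarrow> nat \<Rightarrow> nat \<Rightarrow> int" where
  "cartan k p q i j =
    (if i = j then 2 else if i = 0 then (if j = k then p else 0)
     else if j = 0 then (if i = k then q else 0)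
     else if i = Suc j \<or> j = Suc i then - 1 else 0)"

definition cartan_F4 :: "nat \<Rightarrow> nat \<Rightarrow> int" where
  "cartan_F4 i j = (if i = j then 2 else if i = 1 \<and> j = 2 then - 2
     else if i = Suc j \<or> j = Suc i then - 1 else 0)"

text \<open>
  The state \<open>v\<close> lists the pairings of \<open>w \<rho>\<close> with the simple coroots. Firing \<open>i\<close> replaces \<open>w\<close> by
  \<open>s\<^sub>i w\<close> and raises the atomic length \<open>l\<close> by \<open>v ! i\<close>. In \<open>pending\<close> the values
  met on the way are struck out of the (increasing) list \<open>ks\<close>.
\<close>

definition fire :: "(nat \<Rightarrow> nat \<Rightarrow> int) \<Rightarrow> nat \<Rightarrow> int list \<Rightarrow> int list" where
  "fire C i v = map (\<lambda>j. v ! j - C j i * v ! i) [0..<length v]"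

fun strike :: "int \<Rightarrow> int list \<Rightarrow> int list" where
  "strike l [] = []"
| "strike l (x # xs) = (if x < l then x # strike l xs else if x = l then xs else x # xs)"

primrec pending :: "(nat \<Rightarrow> nat \<Rightarrow> int) \<Rightarrow> int list \<Rightarrow> int \<Rightarrow> int list \<Rightarrow> nat list \<Rightarrow> int list" where
  "pending C v l ks [] = strike l ks"
| "pending C v l ks (i # is) = pending C (fire C i v) (l + v ! i) (strike l ks) is"

definition covers :: "(nat \<Rightarrow> nat \<Rightarrow> int) \<Rightarrow> nat \<Rightarrow> nat list \<Rightarrow> int \<Rightarrow> int \<Rightarrow> bool" where
  "covers C n is a b \<longleftrightarrow> list_all (\<lambda>i. i < n) is \<and>
     pending C (replicate n 1) 0 [a..b] is = []"

text \<open>Soundness of striking: nothing but \<open>l\<close> is ever removed. The early exit at a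
  larger entry could at worst leave a value standing, which makes a check fail but never succeed
  wrongly.\<close>

lemma set_strike: "k \<in> set ks \<Longrightarrow> k \<notin> set (strike l ks) \<Longrightarrow> k = l"
  by (induction l ks rule: strike.induct) (auto split: if_splits)

definition solves :: "(nat \<Rightarrow> nat \<Rightarrow> int) \<Rightarrow> int list \<Rightarrow> bool" where
  "solves C xs \<longleftrightarrow> list_all (\<lambda>i. (\<Sum>j\<leftarrow>[0..<length xs]. C i j * xs ! j) = 2) [0..<length xs]"

lemma solves_sum:
  "solves C xs \<Longrightarrow> i < length xs \<Longrightarrow> (\<Sum>j<length xs. real_of_int (C i j) * real_of_int (xs ! j)) = 2"
proof -
  assume a: "solves C xs" "i < length xs"
  then have "(\<Sum>j\<leftarrow>[0..<length xs]. C i j * xs ! j) = 2" by (simp add: solves_def list_all_iff)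
  then have "(\<Sum>j<length xs. C i j * xs ! j) = 2"
    by (simp add: interv_sum_list_conv_sum_set_nat atLeast0LessThan)
  from arg_cong[OF this, of real_of_int] show ?thesis by simp
qed

text \<open>Turns the linear system in arbitrary rank into a recurrence. Vertex \<open>0\<close>
  does not precede vertex \<open>1\<close> on the path, whence the condition
  \<open>2 \<le> i\<close>; the bond between \<open>0\<close> and \<open>k\<close> is a term of its
  own.\<close>

lemma cartan_sum:
  fixes x :: "nat \<Rightarrow> real"
  assumes "0 < k" "k < n" "i < n"
  shows "(\<Sum>j<n. real_of_int (cartan k p q i j) * x j) =
    2 * x i + (if i = 0 then of_int p * x k else
      (if i = k then of_int q * x 0 else 0) - (if 2 \<le> i then x (i - 1) else 0)
        - (if Suc i < n then x (Suc i) else 0))"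
proof (cases "i = 0")
  case True
  have "(\<Sum>j<n. real_of_int (cartan k p q i j) * x j) =
      (\<Sum>j<n. (if j = 0 then 2 * x j else 0) + (if j = k then of_int p * x j else 0))"
    using assms True by (intro sum.cong) (auto simp: cartan_def)
  then show ?thesis using assms True by (simp add: sum.distrib)
next
  case False
  have "(\<Sum>j<n. real_of_int (cartan k p q i j) * x j) =
      (\<Sum>j<n. (if j = i then 2 * x j else 0) + (if j = 0 then (if i = k then of_int q * x j else 0) else 0)
        - (if j = i - 1 then (if 2 \<le> i then x j else 0) else 0) - (if j = Suc i then x j else 0))"
    using assms False by (intro sum.cong) (auto simp: cartan_def)
  then show ?thesis using assms False by (auto simp: sum.distrib sum_subtractf)
qed

section \<open>The game realised by simple roots\<close>

context based_root_system
begin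

definition realizes :: "'a list \<Rightarrow> (nat \<Rightarrow> nat \<Rightarrow> int) \<Rightarrow> bool" where
  "realizes ds C \<longleftrightarrow> distinct ds \<and> set ds \<subseteq> \<Delta> \<and>
     (\<forall>i<length ds. \<forall>j<length ds. 2 * (ds ! i \<bullet> ds ! j) / (ds ! i \<bullet> ds ! i) = real_of_int (C i j))"

lemma realizes_take: "realizes ds C \<Longrightarrow> realizes (take n ds) C"
  by (auto simp: realizes_def dest: in_set_takeD)

text \<open>The hypotheses on \<open>v\<close> and \<open>l\<close> are the invariant of the game:
  the state belongs to \<open>w\<close>. A value leaves the list only when it is the current atomic
  length, so some group element attains it.\<close>

lemma pending_values:
  assumes ds: "realizes ds C" and w: "w \<in> weyl_group (set ds)" and "length v = length ds"
    and "\<And>i. i < length ds \<Longrightarrow> real_of_int (v ! i) = 2 * (w \<rho> \<bullet> ds ! i) / (ds ! i \<bullet> ds ! i)"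
    and "l = int (L w)" and "list_all (\<lambda>i. i < length ds) is"
    and "k \<in> set ks" "k \<notin> set (pending C v l ks is)"
  shows "k \<in> int ` L ` weyl_group (set ds)"
  using w assms(3-8)
proof (induction "is" arbitrary: w v l ks)
  case Nil
  then show ?case using set_strike[of k ks l] by auto
next
  case (Cons i "is")
  have sub: "set ds \<subseteq> \<Delta>" using ds by (simp add: realizes_def)
  have i: "i < length ds" using Cons by simp
  let ?d = "ds ! i"
  have d: "?d \<in> set ds" using i by simp
  have wD: "w \<in> weyl_group \<Delta>" using Cons weyl_mono[OF sub] by auto
  have vi: "real_of_int (v ! i) = 2 * (w \<rho> \<bullet> ?d) / (?d \<bullet> ?d)" using Cons i by blast
  show ?case
  proof (cases "k \<in> set (strike l ks)")
    case False
    then show ?thesis using set_strike[of k ks l] Cons.prems by auto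
  next
    case True
    show ?thesis
    proof (rule Cons.IH[OF _ _ _ _ _ True])
      show "reflection ?d \<circ> w \<in> weyl_group (set ds)" using reflection_weyl[OF d Cons.prems(1)] .
      show "length (fire C i v) = length ds" using Cons.prems by (simp add: fire_def)
      show "real_of_int (fire C i v ! j) = 2 * ((reflection ?d \<circ> w) \<rho> \<bullet> ds ! j) / (ds ! j \<bullet> ds ! j)"
        if j: "j < length ds" for j
      proof -
        have "real_of_int (C j i) = 2 * (ds ! j \<bullet> ?d) / (ds ! j \<bullet> ds ! j)"
          using ds i j by (simp add: realizes_def)
        moreover have "real_of_int (v ! j) = 2 * (w \<rho> \<bullet> ds ! j) / (ds ! j \<bullet> ds ! j)"
          using Cons j by blast
        moreover have "(reflection ?d \<circ> w) \<rho> = w \<rho> - real_of_int (v ! i) *\<^sub>R ?d"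
          by (simp only: reflection_def vi comp_apply)
        ultimately show ?thesis
          using j Cons.prems(2)
          by (simp add: fire_def inner_diff_left inner_commute[of ?d "ds ! j"] right_diff_distrib
              diff_divide_distrib)
      qed
      have "real_of_int (l + v ! i) = real_of_int (int (L (reflection ?d \<circ> w)))"
        using L_reflection[OF wD, of ?d] d sub vi Cons.prems(4) by auto
      then show "l + v ! i = int (L (reflection ?d \<circ> w))" by (simp only: of_int_eq_iff)
      show "list_all (\<lambda>i. i < length ds) is" using Cons.prems by simp
      show "k \<notin> set (pending C (fire C i v) (l + v ! i) (strike l ks) is)" using Cons.prems by simp
    qed
  qed
qed

lemma covers_values:
  assumes ds: "realizes ds C" "length ds = n" and c: "covers C n is a b" and k: "a \<le> int k" "int k \<le> b"
  shows "k \<in> L ` weyl_group (set ds)"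
proof -
  have "L id = 0" using L_eq[OF id_weyl] by (simp add: H_def representation_zero)
  have "int k \<in> int ` L ` weyl_group (set ds)"
  proof (rule pending_values[OF ds(1) id_weyl])
    fix i assume i: "i < length ds"
    then have "ds ! i \<in> \<Delta>" using ds nth_mem[OF i] by (auto simp: realizes_def)
    from rho_coroot[OF this] show "real_of_int (replicate n 1 ! i) = 2 * (id \<rho> \<bullet> ds ! i) / (ds ! i \<bullet> ds ! i)"
      using i ds(2) by (simp only: id_apply nth_replicate of_int_1)
  next
    show "int k \<in> set [a..b]" using k by simp
    show "int k \<notin> set (pending C (replicate n 1) 0 [a..b] is)" using c by (simp add: covers_def)
  qed (use \<open>L id = 0\<close> c ds in \<open>auto simp: covers_def\<close>)
  then show ?thesis by (simp only: inj_image_mem_iff[OF inj_of_nat])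
qed

text \<open>The factor \<open>c\<close> clears the denominator of the polynomial formulas for the maximal atomic length.\<close>

definition attains :: "'a list \<Rightarrow> nat \<Rightarrow> nat \<Rightarrow> bool" where
  "attains ds c P \<longleftrightarrow> L ` weyl_group (set ds) = {k. c * k \<le> P}"

lemma attains_mono: "set es \<subseteq> set ds \<Longrightarrow> attains es c P \<Longrightarrow> c * k \<le> P \<Longrightarrow> k \<in> L ` weyl_group (set ds)"
  using image_mono[OF weyl_mono[of "set es" "set ds"], of L] by (auto simp only: attains_def)

lemma attains_take: "attains (take m ds) c P \<Longrightarrow> c * k \<le> P \<Longrightarrow> k \<in> L ` weyl_group (set ds)"
  by (rule attains_mono[of "take m ds"]) (auto dest: in_set_takeD)

lemma attains_longest:
  assumes "attains ds c P" "set ds \<subseteq> \<Delta>" "longest_element (set ds) w0"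
  shows "L ` weyl_group (set ds) = {0..L w0}"
proof -
  have "w0 \<in> weyl_group (set ds)" using assms by (simp add: longest_element_def)
  then have "L w0 \<in> {k. c * k \<le> P}" using assms(1) unfolding attains_def by blast
  then have "k \<in> L ` weyl_group (set ds)" if "k \<le> L w0" for k
    using that assms(1) order_trans[OF mult_le_mono2[OF that, of c]] unfolding attains_def by blast
  then show ?thesis using L_le_longest[OF assms(2,3)] by auto
qed

text \<open>The \<open>x j\<close> are the coordinates of the sum of the positive roots.\<close>

lemma attainsI:
  assumes ds: "realizes ds C" and n: "length ds = n" and c: "c > 0"
    and x: "\<And>i. i < n \<Longrightarrow> (\<Sum>j<n. real_of_int (C i j) * x j) = 2"
    and P: "real c * (\<Sum>j<n. x j) = real P"
    and half: "\<And>k. 2 * c * k \<le> P \<Longrightarrow> k \<in> L ` weyl_group (set ds)"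
  shows "attains ds c P"
proof -
  have sub: "set ds \<subseteq> \<Delta>" and dist: "distinct ds" using ds by (auto simp: realizes_def)
  obtain w0 where w0: "longest_element (set ds) w0"
    using longest_element_exists sub simple_subset by blast
  \<comment> \<open>The solution is indexed by positions; \<open>y\<close> moves it to the simple
    roots themselves, as \<open>L_longest_eq\<close> expects.\<close>
  define y where "y \<epsilon> = x (inv_into {..<n} ((!) ds) \<epsilon>)" for \<epsilon>
  have inj: "inj_on ((!) ds) {..<n}" using dist n by (auto simp: inj_on_def nth_eq_iff_index_eq)
  have im: "(!) ds ` {..<n} = set ds" using n by (auto simp: set_conv_nth)
  have y: "y (ds ! j) = x j" if "j < n" for j
    using that inv_into_f_f[OF inj] by (simp add: y_def)
  have sum: "(\<Sum>\<epsilon>\<in>set ds. y \<epsilon> * f \<epsilon>) = (\<Sum>j<n. x j * f (ds ! j))" for f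
    unfolding im[symmetric] sum.reindex[OF inj] by (intro sum.cong) (simp_all add: y)
  have "real (L w0) = (\<Sum>\<delta>\<in>set ds. y \<delta>)"
  proof (rule L_longest_eq[OF sub w0])
    fix \<delta> assume "\<delta> \<in> set ds"
    then obtain i where i: "i < n" "\<delta> = ds ! i" using n by (auto simp: in_set_conv_nth)
    have "(\<Sum>\<epsilon>\<in>set ds. y \<epsilon> * (2 * (\<epsilon> \<bullet> \<delta>) / (\<delta> \<bullet> \<delta>))) =
        (\<Sum>j<n. real_of_int (C i j) * x j)"
      unfolding sum
    proof (rule sum.cong[OF refl])
      fix j assume "j \<in> {..<n}"
      then have "2 * (ds ! i \<bullet> ds ! j) / (ds ! i \<bullet> ds ! i) = real_of_int (C i j)"
        using ds i n by (simp add: realizes_def)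
      then show "x j * (2 * (ds ! j \<bullet> \<delta>) / (\<delta> \<bullet> \<delta>)) = real_of_int (C i j) * x j"
        by (simp only: i inner_commute mult.commute)
    qed
    then show "(\<Sum>\<epsilon>\<in>set ds. y \<epsilon> * (2 * (\<epsilon> \<bullet> \<delta>) / (\<delta> \<bullet> \<delta>))) = 2" using x[OF i(1)] by simp
  qed
  also have "\<dots> = (\<Sum>j<n. x j)" using sum[of "\<lambda>_. 1"] by simp
  finally have "real (c * L w0) = real P" using P by simp
  then have M: "c * L w0 = P" by (simp only: of_nat_eq_iff)
  have "L ` weyl_group (set ds) = {0..L w0}"
  proof (rule fullI[OF sub w0 refl])
    fix k assume "2 * k \<le> L w0"
    then have "c * (2 * k) \<le> c * L w0" by (rule mult_le_mono2)
    then show "k \<in> L ` weyl_group (set ds)" using half[of k] M by (simp add: ac_simps)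
  qed
  also have "\<dots> = {k. c * k \<le> P}" using c by (simp add: M[symmetric] set_eq_iff)
  finally show ?thesis unfolding attains_def .
qed

lemma attains_finiteI:
  assumes ds: "realizes ds C" and n: "length ds = n" "length xs = n"
    and x: "solves C xs" and P: "sum_list xs = int P"
    and half: "\<And>k. 2 * k \<le> P \<Longrightarrow> k \<in> L ` weyl_group (set ds)"
  shows "attains ds 1 P"
proof (rule attainsI[OF ds n(1), where x = "\<lambda>j. real_of_int (xs ! j)"])
  show "(\<Sum>j<n. real_of_int (C i j) * real_of_int (xs ! j)) = 2" if "i < n" for i
    using solves_sum[OF x] that n by simp
  have "(\<Sum>j<n. xs ! j) = int P" using P n(2) by (simp add: sum_list_sum_nth atLeast0LessThan)
  from arg_cong[OF this, of real_of_int]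
  show "real 1 * (\<Sum>j<n. real_of_int (xs ! j)) = real P" by simp
qed (use half in simp_all)

text \<open>The words below were found by a computer search.\<close>

lemma attains_A1:
  assumes ds: "realizes ds (cartan 1 (- 1) (- 1))" "length ds = 1"
  shows "attains ds 1 1"
proof (rule attains_finiteI[OF ds, of "[1]"])
  have c: "covers (cartan 1 (- 1) (- 1)) 1 [] 0 0" by code_simp
  show "k \<in> L ` weyl_group (set ds)" if "2 * k \<le> 1" for k
    using covers_values[OF ds c, of k] that by simp
qed (simp, code_simp, simp)

text \<open>The family starts in rank three: rank two misses the value 2, so it cannot supply the
  range up to half of 10.\<close>

lemma attains_A3:
  assumes ds: "realizes ds (cartan 1 (- 1) (- 1))" "length ds = 3"
  shows "attains ds 1 10"
proof (rule attains_finiteI[OF ds, of "[3, 4, 3]"])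
  have c: "covers (cartan 1 (- 1) (- 1)) 3 [0, 1, 0, 1, 2, 0, 1, 2, 1, 0] 0 5" by code_simp
  show "k \<in> L ` weyl_group (set ds)" if "2 * k \<le> 10" for k
    using covers_values[OF ds c, of k] that by simp
qed (simp, code_simp, simp)

lemma attains_B3:
  assumes ds: "realizes ds (cartan 1 (- 2) (- 1))" "length ds = 3"
  shows "attains ds 1 22"
proof (rule attains_finiteI[OF ds, of "[9, 8, 5]"])
  have c: "covers (cartan 1 (- 2) (- 1)) 3
      [0, 1, 0, 1, 2, 0, 2, 1, 0, 1, 0, 2, 1, 2, 1, 0, 0, 1, 0, 2, 1, 0, 1] 0 11" by code_simp
  show "k \<in> L ` weyl_group (set ds)" if "2 * k \<le> 22" for k
    using covers_values[OF ds c, of k] that by simp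
qed (simp, code_simp, simp)

lemma attains_B4:
  assumes ds: "realizes ds (cartan 1 (- 2) (- 1))" "length ds = 4"
  shows "attains ds 1 50"
proof (rule attains_finiteI[OF ds, of "[16, 15, 12, 7]"])
  \<comment> \<open>Rank three reaches 22, short of half of 50, so the play has to supply 23 to
    25.\<close>
  have c: "covers (cartan 1 (- 2) (- 1)) 4 [0, 1, 0, 3, 2, 1, 0, 1, 1, 2] 23 25" by code_simp
  have "attains (take 3 ds) 1 22" by (rule attains_B3[OF realizes_take[OF ds(1)]]) (simp add: ds)
  then show "k \<in> L ` weyl_group (set ds)" if "2 * k \<le> 50" for k
    using covers_values[OF ds c, of k] attains_take[of 3 ds 1 22 k] that by linarith
qed (simp, code_simp, simp)

lemma attains_C3:
  assumes ds: "realizes ds (cartan 1 (- 1) (- 2))" "length ds = 3"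
  shows "attains ds 1 22"
proof (rule attains_finiteI[OF ds, of "[6, 10, 6]"])
  have c: "covers (cartan 1 (- 1) (- 2)) 3 [0, 1, 0, 1, 0, 1, 2, 1, 2, 1, 0, 1, 2, 1, 0, 1, 2, 1] 0 11" by code_simp
  show "k \<in> L ` weyl_group (set ds)" if "2 * k \<le> 22" for k
    using covers_values[OF ds c, of k] that by simp
qed (simp, code_simp, simp)

lemma attains_C4:
  assumes ds: "realizes ds (cartan 1 (- 1) (- 2))" "length ds = 4"
  shows "attains ds 1 50"
proof (rule attains_finiteI[OF ds, of "[10, 18, 14, 8]"])
  have c: "covers (cartan 1 (- 1) (- 2)) 4 [0, 1, 0, 2, 1, 0, 3, 1, 1, 2, 3, 2] 23 25" by code_simp
  have "attains (take 3 ds) 1 22" by (rule attains_C3[OF realizes_take[OF ds(1)]]) (simp add: ds)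
  then show "k \<in> L ` weyl_group (set ds)" if "2 * k \<le> 50" for k
    using covers_values[OF ds c, of k] attains_take[of 3 ds 1 22 k] that by linarith
qed (simp, code_simp, simp)

lemma attains_D4:
  assumes ds: "realizes ds (cartan 2 (- 1) (- 1))" "length ds = 4"
  shows "attains ds 1 28"
proof (rule attains_finiteI[OF ds, of "[6, 6, 10, 6]"])
  have c: "covers (cartan 2 (- 1) (- 1)) 4
      [0, 1, 2, 0, 1, 2, 0, 1, 3, 0, 0, 2, 3, 2, 0, 1, 2, 0, 3, 2, 1] 0 14" by code_simp
  show "k \<in> L ` weyl_group (set ds)" if "2 * k \<le> 28" for k
    using covers_values[OF ds c, of k] that by simp
qed (simp, code_simp, simp)

lemma attains_D5:
  assumes ds: "realizes ds (cartan 2 (- 1) (- 1))" "length ds = 5"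
  shows "attains ds 1 60"
proof (rule attains_finiteI[OF ds, of "[10, 10, 18, 14, 8]"])
  \<comment> \<open>Rank four reaches 28 and half of 60 is 30: the play supplies 29 and 30.\<close>
  have c: "covers (cartan 2 (- 1) (- 1)) 5 [0, 1, 2, 0, 1, 3, 2, 4, 3, 2] 29 30" by code_simp
  have "attains (take 4 ds) 1 28" by (rule attains_D4[OF realizes_take[OF ds(1)]]) (simp add: ds)
  then show "k \<in> L ` weyl_group (set ds)" if "2 * k \<le> 60" for k
    using covers_values[OF ds c, of k] attains_take[of 4 ds 1 28 k] that by linarith
qed (simp, code_simp, simp)

lemma attains_F4:
  assumes ds: "realizes ds cartan_F4" "length ds = 4"
  shows "attains ds 1 110"
proof (rule attains_finiteI[OF ds, of "[22, 42, 30, 16]"])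
  have c: "covers cartan_F4 4
      [0, 1, 0, 2, 0, 1, 0, 1, 0, 2, 0, 1, 0, 3, 0, 1, 2, 1, 0, 1, 0, 2, 0, 1, 0, 1, 0, 2, 1, 0,
      1, 3, 2, 0, 1, 2, 0, 1, 3, 2, 3, 2, 0, 1, 2, 3, 2, 0, 1, 2, 0, 1, 2, 0, 3, 0, 1, 2, 1, 0,
      2, 1, 0, 0, 3, 2, 0, 3, 3, 2, 1, 0, 2, 1, 3] 0 55" by code_simp
  show "k \<in> L ` weyl_group (set ds)" if "2 * k \<le> 110" for k
    using covers_values[OF ds c, of k] that by simp
qed (simp, code_simp, simp)

lemma attains_E6:
  assumes ds: "realizes ds (cartan 3 (- 1) (- 1))" "length ds = 6"
  shows "attains ds 1 156"
proof (rule attains_finiteI[OF ds, of "[22, 16, 30, 42, 30, 16]"])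
  have c: "covers (cartan 3 (- 1) (- 1)) 6
      [0, 1, 2, 0, 3, 0, 1, 0, 2, 0, 1, 3, 0, 1, 4, 0, 1, 2, 0, 3, 0, 1, 0, 2, 0, 1, 0, 5, 0, 1,
      0, 2, 0, 4, 1, 2, 0, 0, 1, 2, 1, 3, 0, 1, 0, 5, 0, 4, 0, 3, 0, 1, 3, 1, 0, 5, 4, 0, 1, 0,
      1, 3, 0, 1, 5, 4, 3, 2, 1, 3, 3, 4, 0, 2, 3, 1, 1, 2, 1, 0, 3, 0, 1, 5, 4, 3, 2, 5, 3, 0,
      2, 4, 3, 5, 0, 2, 1, 5] 0 78" by code_simp
  show "k \<in> L ` weyl_group (set ds)" if "2 * k \<le> 156" for k
    using covers_values[OF ds c, of k] that by simp
qed (simp, code_simp, simp)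

lemma attains_E7:
  assumes ds: "realizes ds (cartan 3 (- 1) (- 1))" "length ds = 7"
  shows "attains ds 1 399"
proof (rule attains_finiteI[OF ds, of "[49, 34, 66, 96, 75, 52, 27]"])
  \<comment> \<open>The first six vertices form E6 and reach 156; half of 399 ends at 199.\<close>
  have c: "covers (cartan 3 (- 1) (- 1)) 7
      [0, 3, 2, 1, 4, 3, 0, 2, 3, 4, 5, 6, 4, 3, 0, 2, 1, 3, 2, 4, 5, 3, 0, 4, 1, 2, 1, 3, 0, 1,
      0, 2, 3, 0, 4, 0, 2, 0, 3, 0, 1, 0, 2, 0, 3, 0, 1, 0, 2, 4, 0, 0, 6, 1, 4, 0, 6, 1, 5, 1,
      4, 0, 4, 3, 1, 6, 0, 1, 5, 6, 5, 0, 2, 4, 5, 2, 4, 3] 157 199" by code_simp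
  have "attains (take 6 ds) 1 156" by (rule attains_E6[OF realizes_take[OF ds(1)]]) (simp add: ds)
  then show "k \<in> L ` weyl_group (set ds)" if "2 * k \<le> 399" for k
    using covers_values[OF ds c, of k] attains_take[of 6 ds 1 156 k] that by linarith
qed (simp, code_simp, simp)

lemma attains_E8:
  assumes ds: "realizes ds (cartan 3 (- 1) (- 1))" "length ds = 8"
  shows "attains ds 1 1240"
proof (rule attains_finiteI[OF ds, of "[136, 92, 182, 270, 220, 168, 114, 58]"])
  \<comment> \<open>The first seven vertices form E7 and reach 399; half of 1240 is 620.\<close>
  have c: "covers (cartan 3 (- 1) (- 1)) 8
      [0, 3, 2, 1, 4, 3, 0, 2, 3, 4, 5, 6, 7, 4, 3, 0, 2, 1, 3, 2, 4, 5, 6, 3, 4, 5, 0, 3, 2, 1,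
      4, 3, 0, 2, 3, 4, 2, 5, 0, 1, 0, 3, 0, 1, 2, 1, 2, 0, 6, 0, 1, 0, 2, 1, 0, 2, 0, 3, 0, 1,
      0, 2, 3, 0, 1, 2, 1, 2, 1, 0, 7, 0, 1, 0, 2, 0, 1, 0, 2, 0, 1, 0, 0, 3, 2, 0, 4, 0, 1, 0,
      2, 1, 0, 2, 1, 5, 0, 1, 7, 0, 2, 5, 0, 1, 0, 1, 2, 0, 6, 2, 0, 5, 0, 1, 0, 2, 4, 1, 0, 4,
      2, 1, 3, 5, 0, 6, 1, 3, 2, 5, 1, 0, 2, 0, 3, 2, 0, 1, 2, 0, 7, 0, 1, 0, 2, 0, 1, 0, 2, 0,
      1, 0, 4, 0, 1, 0, 2, 0, 1, 0, 2, 0, 3, 0, 1, 0, 2, 0, 1, 0, 2, 0, 4, 0, 2, 0, 1, 6, 1, 0,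
      3, 0, 2, 0, 4, 0, 1, 0, 2, 3, 5, 1, 0, 3, 0, 1, 2, 0, 5, 1, 0, 4, 0, 2, 0, 1, 0, 6, 0, 1,
      2, 0, 0, 3, 1, 2, 0, 3, 0, 5, 2, 0, 5, 0, 7, 0, 2, 1, 0, 0, 4, 1, 7, 6, 4, 3, 2, 0, 1, 2,
      3, 6, 3, 0, 4, 3, 3, 7, 4, 0, 3, 0, 3, 2, 3, 7, 2, 4, 5, 0, 7, 0, 1, 2, 0, 5, 6, 0, 3, 5,
      3, 4, 3, 2, 0, 5, 6, 4, 5, 1, 2, 1, 6, 1, 5, 0, 1, 4, 3, 2, 0, 5, 7, 0, 1, 3, 4, 3, 2, 6,
      5, 4, 3, 1, 4] 400 620" by code_simp
  have "attains (take 7 ds) 1 399" by (rule attains_E7[OF realizes_take[OF ds(1)]]) (simp add: ds)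
  then show "k \<in> L ` weyl_group (set ds)" if "2 * k \<le> 1240" for k
    using covers_values[OF ds c, of k] attains_take[of 7 ds 1 399 k] that by linarith
qed (simp, code_simp, simp)

section \<open>The classical families by induction on the rank\<close>

lemma attains_A:
  assumes "realizes ds (cartan 1 (- 1) (- 1))" "length ds = n" "n \<ge> 3"
  shows "attains ds 6 (n * (n + 1) * (n + 2))"
  using assms(3,1,2)
proof (induction n arbitrary: ds rule: nat_induct_at_least)
  case base
  then show ?case using attains_A3[of ds] by (auto simp: attains_def)
next
  case (Suc n)
  let ?N = "real (Suc n)"
  \<comment> \<open>Inside the path the equations ask for second difference -2, so \<open>x\<close>
    is quadratic in \<open>j\<close> with leading coefficient -1. Its zeros are the positions just
    outside the path, -1 and \<open>Suc n\<close>.\<close>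
  define x where "x j = (real j + 1) * (?N - real j)" for j
  show ?case
  proof (rule attainsI[OF Suc.prems, where x = x])
    show "(\<Sum>j<Suc n. real_of_int (cartan 1 (- 1) (- 1) i j) * x j) = 2" if "i < Suc n" for i
    proof -
      \<comment> \<open>As \<open>x\<close> vanishes just behind the last vertex, the last row obeys
        the same recurrence as the inner ones.\<close>
      have "x (Suc n) = 0" by (simp add: x_def)
      then have "(if Suc i < Suc n then x (Suc i) else 0) = x (Suc i)"
        using that by (auto simp: not_less less_Suc_eq_le dest: antisym)
      moreover have "i = 0 \<or> i = 1 \<or> i \<ge> 2" by linarith
      ultimately show ?thesis using that Suc.hyps
        by (subst cartan_sum) (auto simp: x_def of_nat_diff algebra_simps)
    qed
    have "(\<Sum>j<m. x j) = ?N * m * (m + 1) / 2 - (real m - 1) * m * (m + 1) / 3" for m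
      by (induction m) (simp_all add: x_def field_simps)
    from this[of "Suc n"]
    show "real 6 * (\<Sum>j<Suc n. x j) = real (Suc n * (Suc n + 1) * (Suc n + 2))"
      by (simp add: field_simps)
    fix k assume "2 * 6 * k \<le> Suc n * (Suc n + 1) * (Suc n + 2)"
    also have "\<dots> = (n + 1) * (n + 2) * (n + 3)" by (simp add: algebra_simps)
    \<comment> \<open>Rank at least three enters here, as n + 3 \<le> 2n.\<close>
    also have "\<dots> \<le> (n + 1) * (n + 2) * (2 * n)" using Suc.hyps by (intro mult_le_mono2) simp
    finally have "6 * k \<le> n * (n + 1) * (n + 2)" by (simp add: algebra_simps)
    moreover have "attains (take n ds) 6 (n * (n + 1) * (n + 2))"
      using Suc.prems by (intro Suc.IH realizes_take) simp_all
    ultimately show "k \<in> L ` weyl_group (set ds)" by (intro attains_take)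
  qed simp
qed

lemma attains_B:
  assumes "realizes ds (cartan 1 (- 2) (- 1))" "length ds = n" "n \<ge> 4"
  shows "attains ds 6 (n * (n + 1) * (4 * n - 1))"
  using assms(3,1,2)
proof (induction n arbitrary: ds rule: nat_induct_at_least)
  case base
  then show ?case using attains_B4[of ds] by (auto simp: attains_def)
next
  case (Suc n)
  let ?N = "real (Suc n)"
  \<comment> \<open>Again quadratic, now even about 0: the entry -2 in row 0 counts the neighbour 1
    twice, as if it were mirrored at -1.\<close>
  define x where "x j = (?N - real j) * (?N + real j)" for j
  show ?case
  proof (rule attainsI[OF Suc.prems, where x = x])
    show "(\<Sum>j<Suc n. real_of_int (cartan 1 (- 2) (- 1) i j) * x j) = 2" if "i < Suc n" for i
    proof -
      have "x (Suc n) = 0" by (simp add: x_def)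
      then have "(if Suc i < Suc n then x (Suc i) else 0) = x (Suc i)"
        using that by (auto simp: not_less less_Suc_eq_le dest: antisym)
      moreover have "i = 0 \<or> i = 1 \<or> i \<ge> 2" by linarith
      ultimately show ?thesis using that Suc.hyps
        by (subst cartan_sum) (auto simp: x_def of_nat_diff algebra_simps)
    qed
    have "(\<Sum>j<m. x j) = ?N * ?N * m - (real m - 1) * m * (2 * real m - 1) / 6" for m
      by (induction m) (simp_all add: x_def field_simps)
    from this[of "Suc n"]
    show "real 6 * (\<Sum>j<Suc n. x j) = real (Suc n * (Suc n + 1) * (4 * Suc n - 1))"
      by (simp add: field_simps)
    have "attains (take n ds) 6 (n * (n + 1) * (4 * n - 1))"
      using Suc.prems by (intro Suc.IH realizes_take) simp_all
    moreover fix k assume k: "2 * 6 * k \<le> Suc n * (Suc n + 1) * (4 * Suc n - 1)"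
    have "6 * k \<le> n * (n + 1) * (4 * n - 1)"
    proof -
      \<comment> \<open>Without the factor n + 1 the claim reads (n + 2)(4n + 3) \<le> 2n(4n - 1),
        which fails at n = 3; hence the start at four. Writing n = m + 4 removes truncated
        subtraction and leaves a comparison of coefficients.\<close>
      obtain m where m: "n = m + 4" using Suc.hyps by (metis le_add_diff_inverse2)
      have "2 * (6 * k) \<le> (n + 1) * ((n + 2) * (4 * n + 3))" using k by (simp add: algebra_simps)
      also have "\<dots> \<le> (n + 1) * (2 * (n * (4 * n - 1)))"
        by (intro mult_le_mono2) (simp add: m algebra_simps)
      also have "\<dots> = 2 * (n * (n + 1) * (4 * n - 1))" by (simp only: ac_simps)
      finally show ?thesis by simp
    qed
    ultimately show "k \<in> L ` weyl_group (set ds)" by (intro attains_take)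
  qed simp
qed

lemma attains_C:
  assumes "realizes ds (cartan 1 (- 1) (- 2))" "length ds = n" "n \<ge> 4"
  shows "attains ds 6 (n * (n + 1) * (4 * n - 1))"
  using assms(3,1,2)
proof (induction n arbitrary: ds rule: nat_induct_at_least)
  case base
  then show ?case using attains_C4[of ds] by (auto simp: attains_def)
next
  case (Suc n)
  let ?N = "real (Suc n)"
  \<comment> \<open>The quadratic takes equal values at 0 and -1. It is halved at 0 because the
    entry -2 in row 1 counts vertex 0 twice.\<close>
  define x where "x j = (?N - real j) * (?N + 1 + real j) / (if j = 0 then 2 else 1)" for j
  show ?case
  proof (rule attainsI[OF Suc.prems, where x = x])
    show "(\<Sum>j<Suc n. real_of_int (cartan 1 (- 1) (- 2) i j) * x j) = 2" if "i < Suc n" for i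
    proof -
      have "x (Suc n) = 0" by (simp add: x_def)
      then have "(if Suc i < Suc n then x (Suc i) else 0) = x (Suc i)"
        using that by (auto simp: not_less less_Suc_eq_le dest: antisym)
      moreover have "i = 0 \<or> i = 1 \<or> i \<ge> 2" by linarith
      ultimately show ?thesis using that Suc.hyps
        by (subst cartan_sum) (auto simp: x_def of_nat_diff field_simps)
    qed
    have "(\<Sum>j<m. x j) = ?N * (?N + 1) * m - (m - 1) * real m * (m + 1) / 3 - ?N * (?N + 1) / 2"
      if "m \<ge> 1" for m
      using that by (induction m rule: nat_induct_at_least) (simp_all add: x_def field_simps)
    from this[of "Suc n"]
    show "real 6 * (\<Sum>j<Suc n. x j) = real (Suc n * (Suc n + 1) * (4 * Suc n - 1))"
      by (simp add: field_simps)
    have "attains (take n ds) 6 (n * (n + 1) * (4 * n - 1))"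
      using Suc.prems by (intro Suc.IH realizes_take) simp_all
    moreover fix k assume k: "2 * 6 * k \<le> Suc n * (Suc n + 1) * (4 * Suc n - 1)"
    have "6 * k \<le> n * (n + 1) * (4 * n - 1)"
    proof -
      obtain m where m: "n = m + 4" using Suc.hyps by (metis le_add_diff_inverse2)
      have "2 * (6 * k) \<le> (n + 1) * ((n + 2) * (4 * n + 3))" using k by (simp add: algebra_simps)
      also have "\<dots> \<le> (n + 1) * (2 * (n * (4 * n - 1)))"
        by (intro mult_le_mono2) (simp add: m algebra_simps)
      also have "\<dots> = 2 * (n * (n + 1) * (4 * n - 1))" by (simp only: ac_simps)
      finally show ?thesis by simp
    qed
    ultimately show "k \<in> L ` weyl_group (set ds)" by (intro attains_take)
  qed simp
qed

lemma attains_D: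
  assumes "realizes ds (cartan 2 (- 1) (- 1))" "length ds = n" "n \<ge> 5"
  shows "attains ds 3 (n * (n - 1) * (2 * n - 1))"
  using assms(3,1,2)
proof (induction n arbitrary: ds rule: nat_induct_at_least)
  case base
  then show ?case using attains_D5[of ds] by (auto simp: attains_def)
next
  case (Suc n)
  let ?N = "real (Suc n)"
  \<comment> \<open>The quadratic takes equal values at 0 and 1. These vertices are the two tips of
    the fork, and each carries half of that value.\<close>
  define x where "x j = (?N - real j) * (?N - 1 + real j) / (if j < 2 then 2 else 1)" for j
  show ?case
  proof (rule attainsI[OF Suc.prems, where x = x])
    show "(\<Sum>j<Suc n. real_of_int (cartan 2 (- 1) (- 1) i j) * x j) = 2" if "i < Suc n" for i
    proof -
      have "x (Suc n) = 0" by (simp add: x_def)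
      then have "(if Suc i < Suc n then x (Suc i) else 0) = x (Suc i)"
        using that by (auto simp: not_less less_Suc_eq_le dest: antisym)
      moreover have "i = 0 \<or> i = 1 \<or> i = 2 \<or> i > 2" by linarith
      ultimately show ?thesis using that Suc.hyps
        by (subst cartan_sum) (auto simp: x_def of_nat_diff field_simps)
    qed
    have "(\<Sum>j<m. x j) = ?N * (?N - 1) * (m - 1) - (m - 2) * (real m - 1) * m / 3"
      if "m \<ge> 2" for m
      using that by (induction m rule: nat_induct_at_least) (simp_all add: x_def field_simps eval_nat_numeral)
    from this[of "Suc n"] Suc.hyps
    show "real 3 * (\<Sum>j<Suc n. x j) = real (Suc n * (Suc n - 1) * (2 * Suc n - 1))"
      by (simp add: field_simps)
    have "attains (take n ds) 3 (n * (n - 1) * (2 * n - 1))"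
      using Suc.prems by (intro Suc.IH realizes_take) simp_all
    moreover fix k assume k: "2 * 3 * k \<le> Suc n * (Suc n - 1) * (2 * Suc n - 1)"
    have "3 * k \<le> n * (n - 1) * (2 * n - 1)"
    proof -
      \<comment> \<open>The inequality (n + 1)(2n + 1) \<le> 2(n - 1)(2n - 1) fails at n = 4, hence
        the start at five.\<close>
      obtain m where m: "n = m + 5" using Suc.hyps by (metis le_add_diff_inverse2)
      have "2 * (3 * k) \<le> n * ((n + 1) * (2 * n + 1))" using k by (simp add: algebra_simps)
      also have "\<dots> \<le> n * (2 * ((n - 1) * (2 * n - 1)))"
        by (intro mult_le_mono2) (simp add: m algebra_simps)
      also have "\<dots> = 2 * (n * (n - 1) * (2 * n - 1))" by (simp only: ac_simps)
      finally show ?thesis by simp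
    qed
    ultimately show "k \<in> L ` weyl_group (set ds)" by (intro attains_take)
  qed simp
qed

end

section \<open>Chains of simple roots\<close>

definition pairing :: "'a::real_inner \<Rightarrow> 'a \<Rightarrow> real" where
  "pairing u v = 2 * (u \<bullet> v) / (u \<bullet> u)"

text \<open>Four times the squared cosine of the angle: for distinct simple roots, the number of
  lines joining them in the Dynkin diagram.\<close>

definition bond :: "'a::real_inner \<Rightarrow> 'a \<Rightarrow> real" where
  "bond u v = pairing u v * pairing v u"

lemma bond_sym: "bond u v = bond v u"
  by (simp add: bond_def)

lemma bond_eq: "bond u v = 4 * (u \<bullet> v)\<^sup>2 / ((u \<bullet> u) * (v \<bullet> v))"
  by (simp add: bond_def pairing_def inner_commute power2_eq_square)

text \<open>The sum is four times the squared norm ratio of the projection \<open>p\<close> of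
  \<open>u\<close> to \<open>span S\<close> and \<open>u\<close> itself. It is strict because
  \<open>u\<close> lies outside the span.\<close>

lemma sum_bond_less:
  fixes u :: "'a::euclidean_space"
  assumes "finite S" "u \<notin> span S" "\<And>s t. s \<in> S \<Longrightarrow> t \<in> S \<Longrightarrow> s \<noteq> t \<Longrightarrow> s \<bullet> t = 0"
    and "0 \<notin> S"
  shows "(\<Sum>s\<in>S. bond u s) < 4"
proof -
  define p where "p = (\<Sum>s\<in>S. ((u \<bullet> s) / (s \<bullet> s)) *\<^sub>R s)"
  have "p \<in> span S" unfolding p_def by (intro span_sum span_scale span_base)
  then have "(u - p) \<bullet> (u - p) > 0" using assms(2) by auto
  moreover have ps: "p \<bullet> s = u \<bullet> s" if s: "s \<in> S" for s
  proof -
    have "p \<bullet> s = (\<Sum>t\<in>S. (u \<bullet> t) / (t \<bullet> t) * (t \<bullet> s))" by (simp add: p_def inner_sum_left)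
    also have "\<dots> = (\<Sum>t\<in>S. if t = s then u \<bullet> s else 0)"
      using assms(3,4) s by (intro sum.cong) auto
    finally show ?thesis using s assms(1) by simp
  qed
  have pp: "x \<bullet> p = (\<Sum>s\<in>S. (u \<bullet> s) / (s \<bullet> s) * (x \<bullet> s))" for x by (simp add: p_def inner_sum_right)
  have "p \<bullet> p = u \<bullet> p" unfolding pp[of p] pp[of u] by (intro sum.cong) (simp_all add: ps)
  ultimately have lt: "u \<bullet> p < u \<bullet> u" by (simp add: inner_diff_left inner_diff_right inner_commute)
  have "u \<noteq> 0" using assms(2) span_zero by auto
  then have "(\<Sum>s\<in>S. bond u s) = 4 * (u \<bullet> p) / (u \<bullet> u)"
    unfolding bond_eq pp[of u] sum_distrib_left sum_divide_distrib
    by (intro sum.cong) (simp_all add: power2_eq_square)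
  also have "\<dots> < 4" using lt \<open>u \<noteq> 0\<close> by (simp add: divide_less_eq)
  finally show ?thesis .
qed

lemma inner_le_of_bond:
  fixes u v :: "'a::real_inner"
  assumes "u \<bullet> v \<le> 0" "bond u v \<ge> 1" "u \<noteq> 0" "v \<noteq> 0"
  shows "2 * (u \<bullet> v) \<le> - (norm u * norm v)"
proof (rule ccontr)
  assume "\<not> 2 * (u \<bullet> v) \<le> - (norm u * norm v)"
  then have "- (2 * (u \<bullet> v)) < norm u * norm v" by simp
  then have "(- (2 * (u \<bullet> v)))\<^sup>2 < (norm u * norm v)\<^sup>2"
    using assms(1) by (intro power_strict_mono) auto
  then have "4 * (u \<bullet> v)\<^sup>2 < (u \<bullet> u) * (v \<bullet> v)"
    by (simp add: power_mult_distrib power2_norm_eq_inner)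
  then show False using assms(2-4) by (simp add: bond_eq le_divide_eq mult_less_0_iff split: if_splits)
qed

text \<open>Scaled to unit length, the vectors have pairwise products at most -1/2, so their sum has
  squared norm at most 3 - 3 = 0. Hence a Dynkin diagram contains no triangle.\<close>

lemma obtuse_triangle:
  fixes u v w :: "'a::real_inner"
  assumes "u \<noteq> 0" "v \<noteq> 0" "w \<noteq> 0"
    and uv: "u \<bullet> v \<le> 0" "bond u v \<ge> 1"
    and uw: "u \<bullet> w \<le> 0" "bond u w \<ge> 1"
    and vw: "v \<bullet> w \<le> 0" "bond v w \<ge> 1"
  shows "\<exists>a b c. a > 0 \<and> b > 0 \<and> c > 0 \<and> a *\<^sub>R u + b *\<^sub>R v + c *\<^sub>R w = 0"
proof -
  define a b c where abc: "a = 1 / norm u" "b = 1 / norm v" "c = 1 / norm w"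
  have pos: "a > 0" "b > 0" "c > 0" using assms(1-3) by (auto simp: abc)
  have one: "a * a * (u \<bullet> u) = 1" "b * b * (v \<bullet> v) = 1" "c * c * (w \<bullet> w) = 1"
    using assms(1-3) by (simp_all add: abc norm_eq_sqrt_inner)
  have le: "2 * (a * b * (u \<bullet> v)) \<le> - 1" "2 * (a * c * (u \<bullet> w)) \<le> - 1" "2 * (b * c * (v \<bullet> w)) \<le> - 1"
    using inner_le_of_bond[OF uv assms(1,2)] inner_le_of_bond[OF uw assms(1,3)]
      inner_le_of_bond[OF vw assms(2,3)] assms(1-3)
    by (simp_all add: abc divide_le_eq mult.commute)
  let ?x = "a *\<^sub>R u + b *\<^sub>R v + c *\<^sub>R w"
  have "?x \<bullet> ?x = a * a * (u \<bullet> u) + b * b * (v \<bullet> v) + c * c * (w \<bullet> w)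
      + 2 * (a * b * (u \<bullet> v)) + 2 * (a * c * (u \<bullet> w)) + 2 * (b * c * (v \<bullet> w))"
    by (simp add: inner_simps inner_commute algebra_simps)
  also have "\<dots> \<le> 0" using one le by linarith
  finally have "?x = 0" using inner_ge_zero[of ?x] by (metis antisym inner_eq_zero_iff)
  then show ?thesis using pos by blast
qed

definition is_null :: "(nat \<Rightarrow> nat \<Rightarrow> int) \<Rightarrow> int list \<Rightarrow> bool" where
  "is_null C xs \<longleftrightarrow> list_all (\<lambda>i. (\<Sum>j\<leftarrow>[0..<length xs]. C i j * xs ! j) = 0) [0..<length xs]"

text \<open>A form of the path matrix in which vertex \<open>0\<close> is not special: entries
  depend only on the distance of the indices, so subpaths and reversal preserve it.\<close>

definition cartan_A :: "nat \<Rightarrow> nat \<Rightarrow> int" where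
  "cartan_A i j = (if i = j then 2 else if i = Suc j \<or> j = Suc i then - 1 else 0)"

lemma cartan_A_eq: "cartan_A = cartan 1 (- 1) (- 1)"
  by (auto simp: cartan_A_def cartan_def fun_eq_iff)

section \<open>Paths of single bonds and their contraction\<close>

context based_root_system
begin

lemma pairing_int: "u \<in> \<Phi> \<Longrightarrow> v \<in> \<Phi> \<Longrightarrow> pairing u v \<in> \<int>"
  using crystallographic[of u v] by (simp add: pairing_def inner_commute)

lemma pairing_simple_le: "u \<in> \<Delta> \<Longrightarrow> v \<in> \<Delta> \<Longrightarrow> u \<noteq> v \<Longrightarrow> pairing u v \<le> 0"
  using simple_obtuse[of u v] by (simp add: pairing_def divide_nonpos_nonneg)

lemma pairing_eq_0_iff: "u \<in> \<Delta> \<Longrightarrow> pairing u v = 0 \<longleftrightarrow> u \<bullet> v = 0"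
  using simple_nonzero[of u] by (simp add: pairing_def)

lemma pairing_self: "u \<in> \<Delta> \<Longrightarrow> pairing u u = 2"
  using simple_nonzero[of u] by (simp add: pairing_def)

lemma pairing_simple_cases: "u \<in> \<Delta> \<Longrightarrow> v \<in> \<Delta> \<Longrightarrow> u \<noteq> v \<Longrightarrow> u \<bullet> v \<noteq> 0 \<Longrightarrow> pairing u v \<le> - 1"
proof -
  assume a: "u \<in> \<Delta>" "v \<in> \<Delta>" "u \<noteq> v" "u \<bullet> v \<noteq> 0"
  obtain k :: int where "pairing u v = of_int k"
    using pairing_int[of u v] a simple_subset by (auto elim: Ints_cases)
  then show ?thesis
    using pairing_simple_le[of u v] pairing_eq_0_iff[of u v] a by auto
qed

lemma bond_simple_ge_1: "u \<in> \<Delta> \<Longrightarrow> v \<in> \<Delta> \<Longrightarrow> u \<noteq> v \<Longrightarrow> u \<bullet> v \<noteq> 0 \<Longrightarrow> bond u v \<ge> 1"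
  using mult_mono'[of 1 "- pairing u v" 1 "- pairing v u"] pairing_simple_cases[of u v] pairing_simple_cases[of v u]
  by (simp add: bond_def inner_commute)

lemma realizes_iff: "realizes ds C \<longleftrightarrow> distinct ds \<and> set ds \<subseteq> \<Delta> \<and>
     (\<forall>i<length ds. \<forall>j<length ds. pairing (ds ! i) (ds ! j) = real_of_int (C i j))"
  by (simp add: realizes_def pairing_def)

lemma realizes_pairing:
  "realizes ds C \<Longrightarrow> i < length ds \<Longrightarrow> j < length ds \<Longrightarrow> pairing (ds ! i) (ds ! j) = real_of_int (C i j)"
  by (simp add: realizes_iff)

lemma realizes_nth: "realizes ds C \<Longrightarrow> i < length ds \<Longrightarrow> ds ! i \<in> \<Delta>"
  unfolding realizes_iff using nth_mem by blast

lemma realizes_nth_eq: "realizes ds C \<Longrightarrow> i < length ds \<Longrightarrow> j < length ds \<Longrightarrow> ds ! i = ds ! j \<longleftrightarrow> i = j"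
  by (simp add: realizes_iff nth_eq_iff_index_eq)

text \<open>The combination with coefficients \<open>xs\<close> is orthogonal to every
  \<open>ds ! i\<close>, hence to itself, so it is zero; but its coordinate at the first root is
  \<open>hd xs\<close>.\<close>

lemma realizes_not_null:
  assumes ds: "realizes ds C" and xs: "length xs = length ds" "is_null C xs" "hd xs \<noteq> 0" "xs \<noteq> []"
  shows False
proof -
  let ?n = "length ds"
  have n: "0 < ?n" using xs by (cases xs) auto
  define v where "v = (\<Sum>j<?n. real_of_int (xs ! j) *\<^sub>R ds ! j)"
  have vi: "v \<bullet> ds ! i = 0" if i: "i < ?n" for i
  proof -
    have d: "ds ! i \<in> \<Delta>" using realizes_nth[OF ds i] .
    have "(\<Sum>j\<leftarrow>[0..<length xs]. C i j * xs ! j) = 0" using xs i by (simp add: is_null_def list_all_iff)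
    then have "(\<Sum>j<?n. C i j * xs ! j) = 0"
      using xs(1) by (simp add: interv_sum_list_conv_sum_set_nat atLeast0LessThan)
    from arg_cong[OF this, of real_of_int]
    have "(\<Sum>j<?n. real_of_int (C i j) * real_of_int (xs ! j)) = 0" by simp
    moreover have "(\<Sum>j<?n. real_of_int (C i j) * real_of_int (xs ! j)) = pairing (ds ! i) v"
      unfolding v_def pairing_def inner_sum_right sum_distrib_left sum_divide_distrib
      by (intro sum.cong refl) (simp add: realizes_pairing[OF ds i, symmetric] pairing_def)
    ultimately show ?thesis using pairing_eq_0_iff[OF d] by (simp add: inner_commute)
  qed
  have "v \<bullet> v = (\<Sum>j<?n. real_of_int (xs ! j) * (v \<bullet> ds ! j))"
    by (subst (2) v_def) (simp add: inner_sum_right)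
  then have "v = 0" using vi by simp
  moreover have "rep v (ds ! 0) = real_of_int (xs ! 0)"
  proof -
    have "rep v (ds ! 0) = (\<Sum>j<?n. if j = 0 then real_of_int (xs ! j) else 0)"
      unfolding v_def rep_sum
    proof (intro sum.cong refl)
      fix j assume "j \<in> {..<?n}"
      then show "rep (real_of_int (xs ! j) *\<^sub>R ds ! j) (ds ! 0) = (if j = 0 then real_of_int (xs ! j) else 0)"
        using realizes_nth[OF ds, of j] realizes_nth_eq[OF ds n, of j]
        by (auto simp: rep_scale rep_simple)
    qed
    then show ?thesis using n by simp
  qed
  ultimately show False using xs by (simp add: representation_zero hd_conv_nth)
qed

abbreviation "chain ds \<equiv> realizes ds cartan_A"

lemma chain_drop: "chain ds \<Longrightarrow> chain (drop k ds)"
proof -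
  assume ds: "chain ds"
  have "cartan_A (k + i) (k + j) = cartan_A i j" for i j by (simp add: cartan_A_def)
  then show ?thesis using ds set_drop_subset[of k ds] by (auto simp: realizes_iff)
qed

lemma chain_rev: "chain ds \<Longrightarrow> chain (rev ds)"
proof -
  assume ds: "chain ds"
  have "cartan_A (length ds - Suc i) (length ds - Suc j) = cartan_A i j"
    if "i < length ds" "j < length ds" for i j
    using that unfolding cartan_A_def by (intro if_cong) linarith+
  then show ?thesis using ds by (auto simp: realizes_iff rev_nth)
qed

lemma chain_single: "x \<in> \<Delta> \<Longrightarrow> chain [x]"
  by (auto simp: realizes_iff cartan_A_def pairing_self)

lemma chain_norm:
  assumes "chain ds" "i < length ds" "j < length ds"
  shows "ds ! i \<bullet> ds ! i = ds ! j \<bullet> ds ! j"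
proof -
  have "ds ! i \<bullet> ds ! i = ds ! 0 \<bullet> ds ! 0" if "i < length ds" for i
    using that
  proof (induction i)
    case (Suc i)
    let ?u = "ds ! i" and ?v = "ds ! Suc i"
    have nz: "?u \<noteq> 0" "?v \<noteq> 0"
      using simple_nonzero realizes_nth[OF assms(1)] Suc.prems by auto
    have "pairing ?u ?v = - 1" "pairing ?v ?u = - 1"
      using realizes_pairing[OF assms(1), of i "Suc i"] realizes_pairing[OF assms(1), of "Suc i" i] Suc.prems
      by (simp_all add: cartan_A_def)
    then have "2 * (?u \<bullet> ?v) = - (?u \<bullet> ?u)" "2 * (?u \<bullet> ?v) = - (?v \<bullet> ?v)"
      using nz by (simp_all add: pairing_def divide_eq_eq inner_commute split: if_splits)
    then show ?case using Suc by simp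
  qed simp
  from this[of i] this[of j] assms show ?thesis by simp
qed

text \<open>A new root meets only its predecessor in the sum so far, and twice that product is minus
  its own squared norm: the cross term cancels the new square.\<close>

lemma chain_sum_norm:
  assumes ds: "chain ds" and n: "1 \<le> k" "k \<le> length ds"
  shows "(\<Sum>j<k. ds ! j) \<bullet> (\<Sum>j<k. ds ! j) = ds ! 0 \<bullet> ds ! 0"
  using n(1,2)
proof (induction k rule: nat_induct_at_least)
  case base
  then show ?case by simp
next
  case (Suc k)
  let ?N = "ds ! 0 \<bullet> ds ! 0"
  have k: "k < length ds" using Suc by simp
  have d: "ds ! k \<in> \<Delta>" using realizes_nth[OF ds k] .
  have N: "ds ! k \<bullet> ds ! k = ?N" using chain_norm[OF ds k, of 0] k by fastforce
  have "pairing (ds ! k) (\<Sum>j<k. ds ! j) = (\<Sum>j<k. pairing (ds ! k) (ds ! j))"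
    by (simp add: pairing_def inner_sum_right sum_distrib_left sum_divide_distrib)
  also have "\<dots> = (\<Sum>j<k. if j = k - 1 then - 1 else 0)"
    using k by (intro sum.cong refl) (auto simp: realizes_pairing[OF ds] cartan_A_def)
  also have "\<dots> = - 1" using Suc by simp
  finally have "2 * (ds ! k \<bullet> (\<Sum>j<k. ds ! j)) = - ?N"
    using simple_nonzero[OF d] N by (simp add: pairing_def divide_eq_eq split: if_splits)
  then show ?case using Suc N by (simp add: inner_add_left inner_add_right inner_commute)
qed

text \<open>A chain behaves towards the other simple roots like the single vertex obtained by contracting it.\<close>

lemma chain_contract:
  assumes ds: "chain ds" and S: "S \<subseteq> \<Delta> - set ds"
    and w: "\<And>s. s \<in> S \<Longrightarrow> 0 < w s \<and> (\<exists>a\<in>set ds. w s \<le> bond a s)" and ne: "ds \<noteq> []"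
  shows "(\<Sum>s\<in>S. w s) < 4 \<and> (\<forall>s\<in>S. \<forall>t\<in>S. s \<noteq> t \<longrightarrow> s \<bullet> t = 0)"
proof -
  let ?n = "length ds"
  define g where "g = (\<Sum>j<?n. ds ! j)"
  have sub: "set ds \<subseteq> \<Delta>" and dist: "distinct ds" using ds by (auto simp: realizes_iff)
  have n: "0 < ?n" using ne by simp
  \<comment> \<open>As \<open>g\<close> has the norm of every root of the chain, its pairings are
    plain sums of theirs. All terms are nonpositive, so contraction can only strengthen a
    bond.\<close>
  have gN: "g \<bullet> g = ds ! i \<bullet> ds ! i" if "i < ?n" for i
    using chain_sum_norm[OF ds, of ?n] n chain_norm[OF ds that n] by (simp add: g_def)
  have pg: "pairing g s = (\<Sum>j<?n. pairing (ds ! j) s)" for s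
  proof -
    have "pairing g s = (\<Sum>j<?n. 2 * (ds ! j \<bullet> s) / (g \<bullet> g))"
      by (simp add: pairing_def g_def inner_sum_left sum_distrib_left sum_divide_distrib)
    also have "\<dots> = (\<Sum>j<?n. pairing (ds ! j) s)"
      by (intro sum.cong refl) (simp add: pairing_def gN)
    finally show ?thesis .
  qed
  have gp: "pairing s g = (\<Sum>j<?n. pairing s (ds ! j))" for s
    by (simp add: pairing_def g_def inner_sum_right sum_distrib_left sum_divide_distrib)
  have nonpos: "pairing (ds ! j) s \<le> 0" "pairing s (ds ! j) \<le> 0" "s \<bullet> ds ! j \<le> 0"
    if "j < ?n" "s \<in> S" for j s
    using that S sub nth_mem[OF that(1)] pairing_simple_le simple_obtuse by (metis Diff_iff subsetD)+
  have wg: "w s \<le> bond g s" "1 \<le> bond g s" if s: "s \<in> S" for s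
  proof -
    obtain i where i: "i < ?n" "w s \<le> bond (ds ! i) s" "0 < w s"
      using w[OF s] by (auto simp: in_set_conv_nth)
    have "pairing g s \<le> pairing (ds ! i) s"
      unfolding pg using i nonpos[OF _ s] member_le_sum[of i "{..<?n}" "\<lambda>j. - pairing (ds ! j) s"]
      by (auto simp: sum_negf)
    moreover have "pairing s g \<le> pairing s (ds ! i)"
      unfolding gp using i nonpos[OF _ s] member_le_sum[of i "{..<?n}" "\<lambda>j. - pairing s (ds ! j)"]
      by (auto simp: sum_negf)
    ultimately have "bond (ds ! i) s \<le> bond g s"
      unfolding bond_def
      using nonpos[OF i(1) s] mult_mono'[of "- pairing (ds ! i) s" "- pairing g s" "- pairing s (ds ! i)" "- pairing s g"]
      by simp
    moreover have "1 \<le> bond (ds ! i) s"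
    proof (rule bond_simple_ge_1)
      show "ds ! i \<bullet> s \<noteq> 0" using i by (auto simp: bond_def pairing_def)
    qed (use i s S sub nth_mem[OF i(1)] in auto)
    ultimately show "w s \<le> bond g s" "1 \<le> bond g s" using i by auto
  qed
  have gs: "g \<bullet> s \<le> 0" if "s \<in> S" for s
    unfolding g_def inner_sum_left using nonpos(3)[OF _ that] by (intro sum_nonpos) (simp add: inner_commute)
  \<comment> \<open>The coordinate at \<open>ds ! 0\<close> is 1 on \<open>g\<close> and 0 on
    \<open>S\<close>. This rules out both the linear relation of a triangle and
    \<open>g \<in> span S\<close>.\<close>
  have rep_g: "rep g (ds ! 0) = 1"
  proof -
    have "rep g (ds ! 0) = (\<Sum>j<?n. if j = 0 then 1 else 0)"
      unfolding g_def rep_sum using realizes_nth_eq[OF ds n]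
      by (intro sum.cong refl) (auto simp: rep_simple[OF realizes_nth[OF ds]])
    then show ?thesis using n by simp
  qed
  have rep_S: "rep s (ds ! 0) = 0" if "s \<in> S" for s
    using that S nth_mem[OF n] by (auto simp: rep_simple)
  have "g \<noteq> 0" using rep_g by (auto simp: representation_zero)
  have orth: "s \<bullet> t = 0" if st: "s \<in> S" "t \<in> S" "s \<noteq> t" for s t
  proof (rule ccontr)
    assume "s \<bullet> t \<noteq> 0"
    moreover have "s \<in> \<Delta>" "t \<in> \<Delta>" using st S by auto
    ultimately obtain a b c where abc: "a > 0" "a *\<^sub>R g + b *\<^sub>R s + c *\<^sub>R t = 0"
      using obtuse_triangle[OF \<open>g \<noteq> 0\<close>, of s t] simple_nonzero gs wg st simple_obtuse bond_simple_ge_1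
      by metis
    from arg_cong[OF abc(2), of "\<lambda>v. rep v (ds ! 0)"] show False
      using abc(1) st rep_g rep_S by (simp add: rep_add rep_scale representation_zero)
  qed
  have "(\<Sum>s\<in>S. w s) \<le> (\<Sum>s\<in>S. bond g s)" by (intro sum_mono wg)
  also have "\<dots> < 4"
  proof (rule sum_bond_less)
    show "finite S" using S finite_simple finite_subset by blast
    have SD: "S \<subseteq> \<Delta>" using S by auto
    have "ds ! 0 \<in> \<Delta> - S" using S sub nth_mem[OF n] by auto
    then show "g \<notin> span S" using rep_g in_span_iff[OF SD, of g] by auto
    show "0 \<notin> S" using SD simple_nonzero by auto
  qed (rule orth)
  finally show ?thesis using orth by blast
qed

end

definition extend :: "(nat \<Rightarrow> nat \<Rightarrow> int) \<Rightarrow> nat \<Rightarrow> nat \<Rightarrow> int \<Rightarrow> int \<Rightarrow> nat \<Rightarrow> nat \<Rightarrow> int" where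
  "extend C n k p q i j =
    (if i = n then (if j = n then 2 else if j = k then p else 0)
     else if j = n then (if i = k then q else 0) else C i j)"

section \<open>Attaching further vertices to a path\<close>

context based_root_system
begin

lemma pairing_simple_int:
  assumes "u \<in> \<Delta>" "v \<in> \<Delta>" "u \<noteq> v" "u \<bullet> v \<noteq> 0"
  obtains a b :: int where "a \<ge> 1" "b \<ge> 1" "pairing u v = - of_int a" "pairing v u = - of_int b"
    "bond u v = of_int (a * b)"
proof -
  obtain a b :: int where ab: "pairing u v = of_int a" "pairing v u = of_int b"
    using pairing_int[of u v] pairing_int[of v u] assms simple_subset by (auto elim!: Ints_cases)
  have "pairing u v \<le> - 1" "pairing v u \<le> - 1"
    using assms pairing_simple_cases[of u v] pairing_simple_cases[of v u] by (simp_all add: inner_commute)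
  with ab have "- a \<ge> 1" "- b \<ge> 1" by linarith+
  then show ?thesis using ab by (intro that[of "- a" "- b"]) (auto simp: bond_def)
qed

lemma single_bond:
  assumes "u \<in> \<Delta>" "v \<in> \<Delta>" "u \<noteq> v" "u \<bullet> v \<noteq> 0" "bond u v < 2"
  shows "pairing u v = - 1" "pairing v u = - 1"
proof -
  obtain a b :: int where ab: "a \<ge> 1" "b \<ge> 1" "pairing u v = - of_int a" "pairing v u = - of_int b"
    "bond u v = of_int (a * b)"
    using pairing_simple_int[OF assms(1-4)] .
  then have "a * b < 2" using assms(5) by linarith
  moreover have "a \<le> a * b" "b \<le> a * b" using ab by (simp_all add: mult_le_cancel_left1 mult_le_cancel_right1)
  ultimately have "a = 1" "b = 1" using ab by linarith+
  then show "pairing u v = - 1" "pairing v u = - 1" using ab by auto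
qed

lemma double_bond:
  assumes "u \<in> \<Delta>" "v \<in> \<Delta>" "u \<noteq> v" "u \<bullet> v \<noteq> 0" "bond u v \<ge> 2" "bond u v < 3"
  shows "pairing u v = - 1 \<and> pairing v u = - 2 \<or> pairing u v = - 2 \<and> pairing v u = - 1"
proof -
  obtain a b :: int where ab: "a \<ge> 1" "b \<ge> 1" "pairing u v = - of_int a" "pairing v u = - of_int b"
    "bond u v = of_int (a * b)"
    using pairing_simple_int[OF assms(1-4)] .
  then have "a * b < 3" "a * b \<ge> 2" using assms(5,6) by linarith+
  moreover have "a \<le> a * b" "b \<le> a * b" using ab by (simp_all add: mult_le_cancel_left1 mult_le_cancel_right1)
  ultimately have "a = 1 \<or> a = 2" "b = 1 \<or> b = 2" "a * b = 2" using ab by linarith+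
  then show ?thesis using ab by auto
qed

lemma chain_inner:
  assumes "chain P" "i < length P" "j < length P"
  shows "P ! i \<bullet> P ! j \<noteq> 0 \<longleftrightarrow> i = j \<or> i = Suc j \<or> j = Suc i"
  using pairing_eq_0_iff[OF realizes_nth[OF assms(1,2)], of "P ! j"] realizes_pairing[OF assms]
  by (auto simp: cartan_A_def split: if_splits)

lemma chain_seg:
  assumes P: "chain P" and ij: "i \<le> j" "j < length P"
  shows "chain (drop i (take (Suc j) P))" "drop i (take (Suc j) P) \<noteq> []"
    "set (drop i (take (Suc j) P)) = (!) P ` {i..j}"
proof -
  show "chain (drop i (take (Suc j) P))" by (intro chain_drop realizes_take P)
  show "drop i (take (Suc j) P) \<noteq> []" using ij by auto
  have "set xs = (!) xs ` {0..<length xs}" for xs :: "'a list"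
    by (auto simp: set_conv_nth)
  moreover have "length (drop i (take (Suc j) P)) = Suc j - i" using ij by simp
  ultimately have "set (drop i (take (Suc j) P)) = (!) (drop i (take (Suc j) P)) ` {0..<Suc j - i}"
    by metis
  also have "\<dots> = (\<lambda>k. P ! (i + k)) ` {0..<Suc j - i}"
    using ij by (intro image_cong) auto
  also have "\<dots> = (!) P ` {i..j}"
  proof -
    have "(\<lambda>k. i + k) ` {0..<Suc j - i} = {i..j}"
      using ij by (auto simp: image_iff intro!: bexI[of _ "_ - i"])
    then show ?thesis by (metis image_image)
  qed
  finally show "set (drop i (take (Suc j) P)) = (!) P ` {i..j}" .
qed

lemma chain_touch:
  assumes "chain qs" "x \<in> \<Delta> - set qs" "a \<in> set qs" "a \<bullet> x \<noteq> 0"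
  shows "1 \<le> bond a x"
  using assms bond_simple_ge_1[of a x] by (auto simp: realizes_iff)

text \<open>The bonds leaving a contracted path total less than 4. This lemma and the three after it
  exclude the patterns 1+1+1+1, 2+1+1, 2+2 and 3+1.\<close>

lemma chain_star4:
  assumes qs: "chain qs" and "distinct [x, y, z, t]" "{x, y, z, t} \<subseteq> \<Delta> - set qs"
    and "\<exists>a\<in>set qs. a \<bullet> x \<noteq> 0" "\<exists>a\<in>set qs. a \<bullet> y \<noteq> 0" "\<exists>a\<in>set qs. a \<bullet> z \<noteq> 0" "\<exists>a\<in>set qs. a \<bullet> t \<noteq> 0"
  shows False
proof -
  have "qs \<noteq> []" using assms(4) by auto
  moreover have "0 < (1::real) \<and> (\<exists>a\<in>set qs. 1 \<le> bond a s)" if "s \<in> {x, y, z, t}" for s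
    using that assms chain_touch[OF qs] by (metis empty_iff insert_iff subsetD zero_less_one)
  ultimately have "(\<Sum>s\<in>{x, y, z, t}. 1::real) < 4"
    using chain_contract[OF qs assms(3), of "\<lambda>_. 1"] by blast
  then show False using assms(2) by simp
qed

lemma chain_star3:
  assumes qs: "chain qs" and "distinct [x, y, z]" "{x, y, z} \<subseteq> \<Delta> - set qs"
    and "\<exists>a\<in>set qs. 2 \<le> bond a x" "\<exists>a\<in>set qs. a \<bullet> y \<noteq> 0" "\<exists>a\<in>set qs. a \<bullet> z \<noteq> 0"
  shows False
proof -
  have "qs \<noteq> []" using assms(4) by auto
  moreover have "0 < (if s = x then 2 else 1::real) \<and> (\<exists>a\<in>set qs. (if s = x then 2 else 1) \<le> bond a s)"
    if "s \<in> {x, y, z}" for s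
    using that assms chain_touch[OF qs] by (cases "s = x") auto
  ultimately have "(\<Sum>s\<in>{x, y, z}. if s = x then 2 else 1::real) < 4"
    using chain_contract[OF qs assms(3), of "\<lambda>s. if s = x then 2 else 1"] by blast
  then show False using assms(2) by auto
qed

lemma chain_star22:
  assumes qs: "chain qs" and "x \<noteq> y" "{x, y} \<subseteq> \<Delta> - set qs"
    and "\<exists>a\<in>set qs. 2 \<le> bond a x" "\<exists>a\<in>set qs. 2 \<le> bond a y"
  shows False
proof -
  have "qs \<noteq> []" using assms(4) by auto
  moreover have "0 < (2::real) \<and> (\<exists>a\<in>set qs. 2 \<le> bond a s)" if "s \<in> {x, y}" for s
    using that assms by auto
  ultimately have "(\<Sum>s\<in>{x, y}. 2::real) < 4"
    using chain_contract[OF qs assms(3), of "\<lambda>_. 2"] by blast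
  then show False using assms(2) by simp
qed

lemma chain_star31:
  assumes qs: "chain qs" and "x \<noteq> y" "{x, y} \<subseteq> \<Delta> - set qs"
    and "\<exists>a\<in>set qs. 3 \<le> bond a x" "\<exists>a\<in>set qs. a \<bullet> y \<noteq> 0"
  shows False
proof -
  have "qs \<noteq> []" using assms(4) by auto
  moreover have "0 < (if s = x then 3 else 1::real) \<and> (\<exists>a\<in>set qs. (if s = x then 3 else 1) \<le> bond a s)"
    if "s \<in> {x, y}" for s
    using that assms chain_touch[OF qs] by (cases "s = x") auto
  ultimately have "(\<Sum>s\<in>{x, y}. if s = x then 3 else 1::real) < 4"
    using chain_contract[OF qs assms(3), of "\<lambda>s. if s = x then 3 else 1"] by blast
  then show False using assms(2) by auto
qed

text \<open>Two attachments would close a cycle: contracting the part from \<open>i\<close> to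
  \<open>j - 1\<close> leaves a triangle with \<open>x\<close> and \<open>P ! j\<close>.\<close>

lemma chain_attach_unique:
  assumes P: "chain P" and x: "x \<in> \<Delta> - set P"
    and ij: "i < length P" "j < length P" "P ! i \<bullet> x \<noteq> 0" "P ! j \<bullet> x \<noteq> 0"
  shows "i = j"
proof -
  have False if ij: "i < j" "j < length P" "P ! i \<bullet> x \<noteq> 0" "P ! j \<bullet> x \<noteq> 0" for i j
  proof -
    let ?Q = "drop i (take (Suc (j - 1)) P)"
    have Q: "chain ?Q" "?Q \<noteq> []" "set ?Q = (!) P ` {i..j - 1}"
      using ij by (intro chain_seg[OF P]; linarith)+
    have PD: "set P \<subseteq> \<Delta>" using P by (simp add: realizes_iff)
    have sub: "{x, P ! j} \<subseteq> \<Delta> - set ?Q"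
    proof -
      have "P ! j \<notin> set ?Q" using Q(3) ij realizes_nth_eq[OF P] by auto
      moreover have "x \<notin> set ?Q" using x Q(3) ij by auto
      ultimately show ?thesis using realizes_nth[OF P, of j] ij x by auto
    qed
    have "P ! i \<in> set ?Q" "P ! (j - 1) \<in> set ?Q" using Q(3) ij by auto
    moreover have "P ! (j - 1) \<bullet> P ! j \<noteq> 0" using chain_inner[OF P, of "j - 1" j] ij by simp
    ultimately have "0 < (1::real) \<and> (\<exists>a\<in>set ?Q. 1 \<le> bond a s)" if "s \<in> {x, P ! j}" for s
      using that sub ij chain_touch[OF Q(1)] by (metis empty_iff insert_iff subsetD zero_less_one)
    then have "\<forall>s\<in>{x, P ! j}. \<forall>t\<in>{x, P ! j}. s \<noteq> t \<longrightarrow> s \<bullet> t = 0"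
      using chain_contract[OF Q(1) sub, of "\<lambda>_. 1"] Q(2) by blast
    then have "x \<noteq> P ! j \<longrightarrow> x \<bullet> P ! j = 0" by blast
    then show False using ij(2,4) x nth_mem[of j P] by (auto simp: inner_commute)
  qed
  from this[of i j] this[of j i] ij show ?thesis by (meson linorder_neqE_nat)
qed

lemma realizes_extend:
  assumes ds: "realizes ds C" and y: "y \<in> \<Delta> - set ds" and n: "length ds = n"
    and orth: "\<And>j. j < n \<Longrightarrow> j \<noteq> k \<Longrightarrow> ds ! j \<bullet> y = 0"
    and pq: "pairing y (ds ! k) = of_int p" "pairing (ds ! k) y = of_int q"
  shows "realizes (ds @ [y]) (extend C n k p q)"
proof -
  have "pairing ((ds @ [y]) ! i) ((ds @ [y]) ! j) = real_of_int (extend C n k p q i j)"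
    if "i < Suc n" "j < Suc n" for i j
  proof -
    have o: "pairing y (ds ! j) = 0" "pairing (ds ! j) y = 0" if "j < n" "j \<noteq> k" for j
      using orth[OF that] by (simp_all add: pairing_def inner_commute)
    show ?thesis
      using that n y realizes_pairing[OF ds] pq o
      by (auto simp: extend_def nth_append less_Suc_eq pairing_self)
  qed
  then show ?thesis using ds y n by (simp add: realizes_iff)
qed

text \<open>Putting \<open>x\<close> in front makes it vertex \<open>0\<close>, so position
  \<open>k\<close> of \<open>R\<close> becomes vertex \<open>Suc k\<close>.\<close>

lemma realizes_branch:
  assumes R: "chain R" and x: "x \<in> \<Delta> - set R" and k: "k < length R" "R ! k \<bullet> x \<noteq> 0"
    and pq: "pairing x (R ! k) = of_int p" "pairing (R ! k) x = of_int q"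
  shows "realizes (x # R) (cartan (Suc k) p q)"
proof -
  have "pairing ((x # R) ! i) ((x # R) ! j) = real_of_int (cartan (Suc k) p q i j)"
    if "i < Suc (length R)" "j < Suc (length R)" for i j
  proof -
    have o: "pairing x (R ! j) = 0" "pairing (R ! j) x = 0" if "j < length R" "j \<noteq> k" for j
      using chain_attach_unique[OF R x, of j k] that k by (auto simp: pairing_def inner_commute)
    show ?thesis
    proof (cases i)
      case 0
      then show ?thesis using that x pq o(1) by (cases j) (auto simp: cartan_def pairing_self)
    next
      case (Suc i')
      then show ?thesis using that pq o(2) realizes_pairing[OF R]
        by (cases j) (auto simp: cartan_def cartan_A_def)
    qed
  qed
  then show ?thesis using R x by (simp add: realizes_iff)
qed

lemma chain_snoc:
  assumes P: "chain P" "P \<noteq> []" and x: "x \<in> \<Delta> - set P" and l: "last P \<bullet> x \<noteq> 0" "bond (last P) x < 2"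
  shows "chain (P @ [x])"
proof -
  let ?k = "length P - 1"
  have k: "?k < length P" "last P = P ! ?k" using P by (auto simp: last_conv_nth)
  have lD: "last P \<in> \<Delta>" "last P \<noteq> x" using P x realizes_nth[OF P(1)] k by (auto dest: last_in_set)
  have s: "pairing (last P) x = - 1" "pairing x (last P) = - 1"
    using single_bond[OF lD(1) _ lD(2) l] x by auto
  have "realizes (P @ [x]) (extend cartan_A (length P) ?k (- 1) (- 1))"
  proof (rule realizes_extend[OF P(1) x refl])
    fix j assume "j < length P" "j \<noteq> ?k"
    then show "P ! j \<bullet> x = 0" using chain_attach_unique[OF P(1) x, of j ?k] k l by auto
  qed (use s k in auto)
  moreover have "extend cartan_A (length P) ?k (- 1) (- 1) i j = cartan_A i j"
    if "i < Suc (length P)" "j < Suc (length P)" for i j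
  proof (cases "length P")
    case (Suc m)
    then show ?thesis
      using that by (cases "i = length P"; cases "j = length P") (auto simp: extend_def cartan_A_def)
  qed (use P in simp)
  ultimately show ?thesis by (simp add: realizes_iff)
qed

definition maximal_chain :: "'a list \<Rightarrow> bool" where
  "maximal_chain P \<longleftrightarrow> chain P \<and> P \<noteq> [] \<and> (\<forall>Q. chain Q \<longrightarrow> length Q \<le> length P)"

lemma maximal_chain_exists: "\<Delta> \<noteq> {} \<Longrightarrow> \<exists>P. maximal_chain P"
proof -
  assume "\<Delta> \<noteq> {}"
  then obtain x where x: "x \<in> \<Delta>" by blast
  have "length Q < Suc (card \<Delta>)" if "chain Q" for Q
    using that card_mono[OF finite_simple, of "set Q"] by (simp add: realizes_iff distinct_card)
  then obtain P where P: "chain P" "\<And>Q. chain Q \<Longrightarrow> length Q \<le> length P"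
    using ex_has_greatest_nat[of chain "[x]" length "Suc (card \<Delta>)"] chain_single[OF x] by auto
  then have "P \<noteq> []" using P(2)[OF chain_single[OF x]] by auto
  then show ?thesis using P by (auto simp: maximal_chain_def)
qed

lemma maximal_chain_rev: "maximal_chain P \<Longrightarrow> maximal_chain (rev P)"
  by (auto simp: maximal_chain_def chain_rev)

text \<open>A single bond at the end would prolong the path.\<close>

lemma maximal_chain_last_bond:
  assumes "maximal_chain P" "x \<in> \<Delta> - set P" "last P \<bullet> x \<noteq> 0"
  shows "bond (last P) x \<ge> 2"
proof (rule ccontr)
  assume "\<not> bond (last P) x \<ge> 2"
  then have "chain (P @ [x])" using assms by (intro chain_snoc) (auto simp: maximal_chain_def)
  then have "length (P @ [x]) \<le> length P" using assms(1) unfolding maximal_chain_def by blast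
  then show False by simp
qed

end

section \<open>The shape of the Dynkin diagram\<close>

definition agree :: "nat \<Rightarrow> (nat \<Rightarrow> nat \<Rightarrow> int) \<Rightarrow> (nat \<Rightarrow> nat \<Rightarrow> int) \<Rightarrow> bool" where
  "agree n C D \<longleftrightarrow> list_all (\<lambda>i. list_all (\<lambda>j. C i j = D i j) [0..<n]) [0..<n]"

context based_root_system
begin

lemma realizes_agree: "realizes ds C \<Longrightarrow> length ds = n \<Longrightarrow> agree n C D \<Longrightarrow> realizes ds D"
  by (simp add: realizes_iff agree_def list_all_iff)

definition connected_simple :: bool where
  "connected_simple \<longleftrightarrow> (\<forall>K. K \<subset> \<Delta> \<longrightarrow> K \<noteq> {} \<longrightarrow> (\<exists>u\<in>K. \<exists>v\<in>\<Delta> - K. u \<bullet> v \<noteq> 0))"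

lemma connected_simpleD:
  "connected_simple \<Longrightarrow> K \<subseteq> \<Delta> \<Longrightarrow> K \<noteq> {} \<Longrightarrow> K \<noteq> \<Delta> \<Longrightarrow> \<exists>u\<in>K. \<exists>v\<in>\<Delta> - K. u \<bullet> v \<noteq> 0"
  unfolding connected_simple_def by blast

text \<open>\<open>R ! r\<close> is the branching vertex, with arms of lengths 1, \<open>r\<close>
  and at least \<open>r\<close>. Arm 1 gives D; arm 2 gives E, bounded by affine E8; arm 3 or more
  contains affine E7.\<close>

lemma attains_branch:
  assumes R: "chain R" and x: "x \<in> \<Delta> - set R" "R ! r \<bullet> x \<noteq> 0" "bond (R ! r) x < 2"
    and r: "1 \<le> r" "2 * r < length R"
  shows "\<exists>c M. attains (x # R) c M"
proof -
  have rl: "r < length R" using r by simp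
  have s: "pairing (R ! r) x = - 1" "pairing x (R ! r) = - 1"
    using single_bond[OF realizes_nth[OF R rl] _ _ x(2,3)] x(1) nth_mem[OF rl] by auto
  have br: "realizes (x # R) (cartan (Suc r) (- 1) (- 1))"
    using realizes_branch[OF R x(1) rl x(2), of "- 1" "- 1"] s by simp
  consider "r = 1" | "r = 2" | "r \<ge> 3" using r by linarith
  then show ?thesis
  proof cases
    case 1
    then have br2: "realizes (x # R) (cartan 2 (- 1) (- 1))" using br by (simp add: numeral_2_eq_2)
    have "length (x # R) = 4 \<or> length (x # R) \<ge> 5" using r 1 by auto
    then show ?thesis using attains_D4[OF br2] attains_D[OF br2 refl] by blast
  next
    case 2
    then have br3: "realizes (x # R) (cartan 3 (- 1) (- 1))" using br by (simp add: numeral_3_eq_3)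
    have "length (x # R) < 9"
    proof (rule ccontr)
      assume "\<not> length (x # R) < 9"
      then have l: "length (take 9 (x # R)) = 9" by simp
      \<comment> \<open>the affine diagram \<open>E\<^sub>8\<close>\<close>
      have "is_null (cartan 3 (- 1) (- 1)) [3, 2, 4, 6, 5, 4, 3, 2, 1]" by code_simp
      then show False
        using realizes_not_null[OF realizes_take[OF br3, of 9], of "[3, 2, 4, 6, 5, 4, 3, 2, 1]"] l by simp
    qed
    then have "length (x # R) = 6 \<or> length (x # R) = 7 \<or> length (x # R) = 8" using r 2 by auto
    then show ?thesis using attains_E6[OF br3] attains_E7[OF br3] attains_E8[OF br3] by blast
  next
    case 3
    let ?Q = "drop (r - 3) (take (Suc (r + 3)) R)"
    have Q: "chain ?Q" by (intro chain_drop realizes_take R)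
    have len: "length ?Q = 7" using r 3 by simp
    have nth: "?Q ! 3 = R ! r" using r 3 by simp
    have xQ: "x \<in> \<Delta> - set ?Q" using x(1) by (auto dest: in_set_takeD in_set_dropD)
    have "realizes (x # ?Q) (cartan (Suc 3) (- 1) (- 1))"
      using realizes_branch[OF Q xQ, of 3 "- 1" "- 1"] len nth x s by simp
    \<comment> \<open>the affine diagram \<open>E\<^sub>7\<close>\<close>
    moreover have "is_null (cartan (Suc 3) (- 1) (- 1)) [2, 1, 2, 3, 4, 3, 2, 1]" by code_simp
    ultimately show ?thesis
      using realizes_not_null[of "x # ?Q" _ "[2, 1, 2, 3, 4, 3, 2, 1]"] len by auto
  qed
qed

text \<open>By maximality \<open>x\<close> hangs on a multiple bond. Either it completes the
  diagram, giving B or C, or the diagram goes on behind it and must be F4.\<close>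

lemma attains_end_branch:
  assumes conn: "connected_simple" and card: "card \<Delta> \<ge> 3"
    and P: "maximal_chain P" and x: "x \<in> \<Delta> - set P" "last P \<bullet> x \<noteq> 0"
  shows "\<exists>ds c M. set ds = \<Delta> \<and> attains ds c M"
proof -
  have cP: "chain P" "P \<noteq> []" and max: "\<And>Q. chain Q \<Longrightarrow> length Q \<le> length P"
    using P by (auto simp: maximal_chain_def)
  have PD: "set P \<subseteq> \<Delta>" "distinct P" using cP by (auto simp: realizes_iff)
  define m where "m = length P"
  define l where "l = last P"
  have m: "m \<ge> 1" using cP(2) by (cases P) (auto simp: m_def)
  have l: "l = P ! (m - 1)" "l \<in> set P" "l \<in> \<Delta>" "l \<noteq> x"
    using cP PD x by (auto simp: l_def m_def last_conv_nth)
  have lx: "l \<bullet> x \<noteq> 0" "bond l x \<ge> 2"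
    using x maximal_chain_last_bond[OF P x] by (auto simp: l_def)
  have single: "chain [x]" "chain [l]" using chain_single x l by auto
  \<comment> \<open>A longest path with one vertex means that there are no single bonds, so in rank
    three some vertex would carry two multiple bonds.\<close>
  have "m \<noteq> 1"
  proof
    assume m1: "m = 1"
    then have P1: "P = [l]" using cP by (cases P) (auto simp: m_def l_def)
    have "{l, x} \<noteq> \<Delta>" using card card_insert_le_m1[of 2 "{x}" l] by auto
    then obtain u y where uy: "u \<in> {l, x}" "y \<in> \<Delta> - {l, x}" "u \<bullet> y \<noteq> 0"
      using connected_simpleD[OF conn, of "{l, x}"] l x by auto
    then consider "l \<bullet> y \<noteq> 0" | "x \<bullet> y \<noteq> 0" by auto
    then show False
    proof cases
      case 1
      then have "bond l y \<ge> 2" using maximal_chain_last_bond[OF P, of y] uy P1 by auto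
      then show False using chain_star22[OF single(2), of x y] lx uy x l by auto
    next
      case 2
      have "maximal_chain [x]" using single(1) max m1 by (auto simp: maximal_chain_def m_def)
      then have "bond x y \<ge> 2" using maximal_chain_last_bond[of "[x]" y] uy 2 by auto
      then show False using chain_star22[OF single(1), of l y] lx uy x l by (auto simp: bond_sym)
    qed
  qed
  then have m2: "m \<ge> 2" using m by simp
  define q where "q = P ! (m - 2)"
  have q: "q \<in> set P" "q \<in> \<Delta>" "q \<noteq> l" "q \<noteq> x" "l \<bullet> q \<noteq> 0"
  proof -
    show "q \<in> set P" using m2 by (simp add: q_def m_def)
    then show "q \<in> \<Delta>" "q \<noteq> x" using PD x by auto
    show "q \<noteq> l" "l \<bullet> q \<noteq> 0"
      using m2 realizes_nth_eq[OF cP(1), of "m - 2" "m - 1"] chain_inner[OF cP(1), of "m - 1" "m - 2"]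
      by (auto simp: q_def l m_def)
  qed
  \<comment> \<open>A triple bond is excluded by the pattern 3+1, as \<open>l\<close> also meets
    \<open>q\<close>.\<close>
  have lx3: "bond l x < 3"
    using chain_star31[OF single(2), of x q] lx q x l by (force simp: not_less)
  \<comment> \<open>A further vertex at the far end would again need a multiple bond: contract all
    of \<open>P\<close> for 2+2. Elsewhere contract the part from \<open>k\<close> to the end, which
    meets \<open>x\<close>, \<open>P ! (k - 1)\<close> and \<open>y\<close>: 2+1+1.\<close>
  have none: "P ! k \<bullet> y = 0" if y: "y \<in> \<Delta> - set P" "y \<noteq> x" and k: "k < m" for y k
  proof (rule ccontr)
    assume ky: "P ! k \<bullet> y \<noteq> 0"
    show False
    proof (cases "k = 0")
      case True
      then have "last (rev P) \<bullet> y \<noteq> 0" using ky cP by (simp add: last_rev hd_conv_nth)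
      then have "bond (P ! 0) y \<ge> 2"
        using maximal_chain_last_bond[OF maximal_chain_rev[OF P], of y] y cP
        by (simp add: last_rev hd_conv_nth)
      moreover have "P ! 0 \<in> set P" using cP by simp
      ultimately show False using chain_star22[OF cP(1), of x y] x y lx l by blast
    next
      case False
      let ?Q = "drop k (take (Suc (m - 1)) P)"
      have Q: "chain ?Q" "set ?Q = (!) P ` {k..m - 1}"
        using k m by (intro chain_seg[OF cP(1)]; simp add: m_def)+
      have "P ! (k - 1) \<notin> set ?Q" using Q(2) False k realizes_nth_eq[OF cP(1)] by (auto simp: m_def)
      moreover have P1: "P ! (k - 1) \<in> set P" using k by (simp add: m_def)
      moreover have "set ?Q \<subseteq> set P" by (blast dest: in_set_dropD in_set_takeD)
      ultimately have "{x, P ! (k - 1), y} \<subseteq> \<Delta> - set ?Q" using x y PD by auto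
      moreover have "distinct [x, P ! (k - 1), y]" using x y P1 by auto
      moreover have "\<exists>a\<in>set ?Q. 2 \<le> bond a x" using Q(2) l(1) lx k by auto
      moreover have "\<exists>a\<in>set ?Q. a \<bullet> P ! (k - 1) \<noteq> 0"
        unfolding Q(2) using chain_inner[OF cP(1), of k "k - 1"] False k
        by (intro bexI[of _ "P ! k"]) (auto simp: m_def)
      moreover have "\<exists>a\<in>set ?Q. a \<bullet> y \<noteq> 0" using Q(2) ky k by auto
      ultimately show False using chain_star3[OF Q(1)] by blast
    qed
  qed
  have none': "u \<bullet> y = 0" if "y \<in> \<Delta> - set P" "y \<noteq> x" "u \<in> set P" for u y
    using none[OF that(1,2)] that(3) by (auto simp: in_set_conv_nth m_def)
  have dbl: "pairing l x = - 1 \<and> pairing x l = - 2 \<or> pairing l x = - 2 \<and> pairing x l = - 1"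
    using double_bond[of l x] l x lx lx3 by auto
  show ?thesis
  proof (cases "\<Delta> = insert x (set P)")
    case True
    \<comment> \<open>Reversal makes \<open>l\<close> vertex 1, next to \<open>x\<close> as vertex
      0; the direction of the double bond decides between B and C.\<close>
    have R: "chain (rev P)" "rev P ! 0 = l" "0 < length (rev P)" "x \<in> \<Delta> - set (rev P)"
      using chain_rev[OF cP(1)] cP(2) x by (auto simp: l_def rev_nth last_conv_nth)
    note br = realizes_branch[OF R(1,4,3), unfolded R(2), OF lx(1)]
    have len: "length (x # rev P) = 3 \<or> length (x # rev P) \<ge> 4" using m2 by (auto simp: m_def)
    have "\<exists>c M. attains (x # rev P) c M"
      using dbl
    proof
      assume "pairing l x = - 1 \<and> pairing x l = - 2"
      then have "realizes (x # rev P) (cartan 1 (- 2) (- 1))" using br[of "- 2" "- 1"] by simp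
      then show ?thesis using len attains_B3 attains_B by blast
    next
      assume "pairing l x = - 2 \<and> pairing x l = - 1"
      then have "realizes (x # rev P) (cartan 1 (- 1) (- 2))" using br[of "- 1" "- 2"] by simp
      then show ?thesis using len attains_C3 attains_C by blast
    qed
    then show ?thesis using True by (metis list.simps(15) set_rev)
  next
    case False
    then obtain u y where "u \<in> insert x (set P)" "y \<in> \<Delta> - insert x (set P)" "u \<bullet> y \<noteq> 0"
      using connected_simpleD[OF conn, of "insert x (set P)"] x PD by auto
    then have y: "y \<in> \<Delta> - set P" "y \<noteq> x" "x \<bullet> y \<noteq> 0" using none' by auto
    have yl: "y \<noteq> l" "y \<noteq> q" using y l q by auto
    have "bond x y < 2"
      using chain_star22[OF single(1), of l y] lx l x y yl by (force simp: bond_sym not_less)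
    then have xy: "pairing x y = - 1" "pairing y x = - 1" using single_bond[of x y] x y by auto
    have orthP: "P ! j \<bullet> x = 0" if "j < m" "j \<noteq> m - 1" for j
      using chain_attach_unique[OF cP(1) x(1), of j "m - 1"] that lx(1) l(1) cP(2) by (auto simp: m_def)
    \<comment> \<open>Three path vertices before \<open>x\<close>, together with \<open>x\<close>
      and \<open>y\<close>, would already form an affine diagram, whichever way the double bond
      points.\<close>
    have "m = 2"
    proof (rule ccontr)
      assume "m \<noteq> 2"
      then have m3: "m \<ge> 3" using m2 by simp
      let ?Q = "drop (m - 3) P"
      have Q: "chain ?Q" "length ?Q = 3" using chain_drop[OF cP(1)] m3 by (auto simp: m_def)
      have Qn: "?Q ! j = P ! (m - 3 + j)" if "j < 3" for j using that m3 by (simp add: m_def)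
      have subQ: "set ?Q \<subseteq> set P" by (rule set_drop_subset)
      have "m - 3 + 2 = m - 1" using m3 by simp
      then have Q2: "?Q ! 2 = l" using Qn[of 2] l(1) by (simp del: add_2_eq_Suc')
      have ext: "realizes ((?Q @ [x]) @ [y]) (extend (extend cartan_A 3 2 p p') 4 3 (- 1) (- 1))"
        if pp: "pairing x l = of_int p" "pairing l x = of_int p'" for p p'
      proof (rule realizes_extend)
        show "realizes (?Q @ [x]) (extend cartan_A 3 2 p p')"
        proof (rule realizes_extend[OF Q(1) _ Q(2)])
          fix j :: nat assume "j < 3" "j \<noteq> 2"
          then show "?Q ! j \<bullet> x = 0" using Qn orthP[of "m - 3 + j"] m3 by simp
        qed (use x subQ Q2 pp in auto)
        fix j :: nat assume j: "j < 4" "j \<noteq> 3"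
        then have "?Q ! j \<in> set P" using nth_mem[of j ?Q] Q(2) subQ by auto
        then show "(?Q @ [x]) ! j \<bullet> y = 0" using none'[OF y(1,2)] j Q(2) by (simp add: nth_append)
      qed (use y subQ Q(2) xy in \<open>auto simp: nth_append\<close>)
      have len: "length ((?Q @ [x]) @ [y]) = 5" using Q(2) by simp
      from dbl show False
        \<comment> \<open>the affine diagram \<open>F\<^sub>4\<close> and its dual\<close>
      proof
        assume "pairing l x = - 1 \<and> pairing x l = - 2"
        then have "realizes ((?Q @ [x]) @ [y]) (extend (extend cartan_A 3 2 (- 2) (- 1)) 4 3 (- 1) (- 1))"
          using ext[of "- 2" "- 1"] by simp
        moreover have "is_null (extend (extend cartan_A 3 2 (- 2) (- 1)) 4 3 (- 1) (- 1)) [1, 2, 3, 4, 2]"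
          by code_simp
        ultimately show False
          using realizes_not_null[of "(?Q @ [x]) @ [y]" _ "[1, 2, 3, 4, 2]"] len by simp
      next
        assume "pairing l x = - 2 \<and> pairing x l = - 1"
        then have "realizes ((?Q @ [x]) @ [y]) (extend (extend cartan_A 3 2 (- 1) (- 2)) 4 3 (- 1) (- 1))"
          using ext[of "- 1" "- 2"] by simp
        moreover have "is_null (extend (extend cartan_A 3 2 (- 1) (- 2)) 4 3 (- 1) (- 1)) [1, 2, 3, 2, 1]"
          by code_simp
        ultimately show False
          using realizes_not_null[of "(?Q @ [x]) @ [y]" _ "[1, 2, 3, 2, 1]"] len by simp
      qed
    qed
    then have Pql: "P = [q, l]"
      by (intro nth_equalityI) (auto simp: m_def q_def l less_2_cases_iff)
    have cxy: "chain [x, y]" using chain_snoc[OF single(1), of y] x y \<open>bond x y < 2\<close> by auto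
    show ?thesis
    proof (cases "\<Delta> = {q, l, x, y}")
      case True
      have o: "q \<bullet> x = 0" "q \<bullet> y = 0" "l \<bullet> y = 0"
        using orthP[of 0] \<open>m = 2\<close> Pql none'[OF y(1,2)] by auto
      have len: "length [q, l, x, y] = 4" "length [y, x, l, q] = 4" by simp_all
      \<comment> \<open>\<open>cartan_F4\<close> has its -2 in row 1, so vertex 1 is the shorter
        root at the double bond; the list starts from the end on that side.\<close>
      from dbl show ?thesis
      proof
        assume d: "pairing l x = - 2 \<and> pairing x l = - 1"
        have "realizes ((P @ [x]) @ [y]) (extend (extend cartan_A 2 1 (- 1) (- 2)) 3 2 (- 1) (- 1))"
          by (intro realizes_extend[where n = 3] realizes_extend[where n = 2] cP(1))
            (use x y o d xy Pql in \<open>auto simp: less_Suc_eq nth_Cons numeral_eq_Suc split: nat.split\<close>)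
        moreover have "agree 4 (extend (extend cartan_A 2 1 (- 1) (- 2)) 3 2 (- 1) (- 1)) cartan_F4"
          by code_simp
        moreover have "(P @ [x]) @ [y] = [q, l, x, y]" using Pql by simp
        ultimately have "realizes [q, l, x, y] cartan_F4" using realizes_agree[OF _ len(1)] by metis
        then show ?thesis using attains_F4[OF _ len(1)] True by (metis list.set(1) list.simps(15))
      next
        assume d: "pairing l x = - 1 \<and> pairing x l = - 2"
        have "chain [y, x]" using chain_rev[OF cxy] by simp
        have "realizes (([y, x] @ [l]) @ [q]) (extend (extend cartan_A 2 1 (- 1) (- 2)) 3 2 (- 1) (- 1))"
        proof (intro realizes_extend[where n = 3] realizes_extend[where n = 2] \<open>chain [y, x]\<close>)
          have "chain [q, l]" using cP Pql by simp
          from realizes_pairing[OF this, of 0 1] realizes_pairing[OF this, of 1 0]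
          show "pairing q (([y, x] @ [l]) ! 2) = of_int (- 1)" "pairing (([y, x] @ [l]) ! 2) q = of_int (- 1)"
            by (simp_all add: cartan_A_def)
        qed (use x y o d xy l q yl in \<open>auto simp: less_Suc_eq nth_Cons numeral_eq_Suc inner_commute split: nat.split\<close>)
        moreover have "agree 4 (extend (extend cartan_A 2 1 (- 1) (- 2)) 3 2 (- 1) (- 1)) cartan_F4"
          by code_simp
        moreover have "([y, x] @ [l]) @ [q] = [y, x, l, q]" by simp
        ultimately have "realizes [y, x, l, q] cartan_F4" using realizes_agree[OF _ len(2)] by metis
        moreover have "set [y, x, l, q] = \<Delta>" using True by auto
        ultimately show ?thesis using attains_F4[OF _ len(2)] by blast
      qed
    next
      case False
      then obtain u z where uz: "u \<in> {q, l, x, y}" "z \<in> \<Delta> - {q, l, x, y}" "u \<bullet> z \<noteq> 0"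
        using connected_simpleD[OF conn, of "{q, l, x, y}"] x y q l by auto
      then have z: "z \<in> \<Delta> - set P" "z \<noteq> x" "z \<noteq> y" using Pql by auto
      \<comment> \<open>At \<open>x\<close> the pattern is 2+1+1. At \<open>y\<close> a single bond
        gives a path of three vertices, longer than \<open>P\<close>, and a multiple bond gives 2+2
        around \<open>[x, y]\<close>.\<close>
      consider "x \<bullet> z \<noteq> 0" | "y \<bullet> z \<noteq> 0" using uz none'[OF z(1,2)] Pql by auto
      then show ?thesis
      proof cases
        case 1
        then show ?thesis
          using chain_star3[OF single(1), of l y z] lx l x y z yl uz by (auto simp: bond_sym)
      next
        case 2
        show ?thesis
        proof (cases "bond y z < 2")
          case True
          have "chain ([x, y] @ [z])" using chain_snoc[OF cxy, of z] z 2 True by auto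
          then have "length ([x, y] @ [z]) \<le> length P" by (rule max)
          then show ?thesis using Pql by simp
        next
          case False
          then show ?thesis
            using chain_star22[OF cxy, of l z] lx l x y z yl uz by (auto simp: bond_sym)
        qed
      qed
    qed
  qed
qed

text \<open>All attachments are at inner vertices of \<open>P\<close>, which already have two
  neighbours. There is exactly one, and it has no continuation, so the diagram has type D or
  E.\<close>

lemma attains_inner_branch:
  assumes conn: "connected_simple"
    and P: "maximal_chain P" and ne: "set P \<noteq> \<Delta>"
    and ends: "\<And>x. x \<in> \<Delta> - set P \<Longrightarrow> P ! 0 \<bullet> x = 0" "\<And>x. x \<in> \<Delta> - set P \<Longrightarrow> last P \<bullet> x = 0"
  shows "\<exists>ds c M. set ds = \<Delta> \<and> attains ds c M"
proof -
  have cP: "chain P" "P \<noteq> []" and max: "\<And>Q. chain Q \<Longrightarrow> length Q \<le> length P"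
    using P by (auto simp: maximal_chain_def)
  have PD: "set P \<subseteq> \<Delta>" "distinct P" using cP by (auto simp: realizes_iff)
  define m where "m = length P"
  have inner: "1 \<le> k \<and> Suc k < m" if "k < m" "x \<in> \<Delta> - set P" "P ! k \<bullet> x \<noteq> 0" for k x
    using ends[OF that(2)] that cP(2) by (cases "k = m - 1"; cases "k = 0") (auto simp: m_def last_conv_nth)
  obtain u x where "u \<in> set P" and x: "x \<in> \<Delta> - set P" and "u \<bullet> x \<noteq> 0"
    using connected_simpleD[OF conn, of "set P"] ne PD cP by auto
  then obtain k where k: "k < m" "P ! k \<bullet> x \<noteq> 0" by (auto simp: in_set_conv_nth m_def)
  have k': "1 \<le> k" "Suc k < m" using inner[OF k(1) x k(2)] by auto
  let ?a = "P ! (k - 1)" and ?b = "P ! k" and ?c = "P ! Suc k"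
  have abc: "?a \<in> set P" "?b \<in> set P" "?c \<in> set P" using k' by (simp_all add: m_def)
  have abcn: "?a \<noteq> ?b" "?c \<noteq> ?b" "?a \<noteq> ?c" "?b \<bullet> ?a \<noteq> 0" "?b \<bullet> ?c \<noteq> 0"
    using k' realizes_nth_eq[OF cP(1)] chain_inner[OF cP(1), of k] by (auto simp: m_def)
  \<comment> \<open>A multiple bond would give the pattern 2+1+1 at \<open>P ! k\<close>.\<close>
  have bx: "bond ?b x < 2"
  proof (rule ccontr)
    assume "\<not> bond ?b x < 2"
    moreover have "chain [?b]" using chain_single abc PD by auto
    ultimately show False using chain_star3[of "[?b]" x ?a ?c] x abc abcn PD by auto
  qed
  \<comment> \<open>Contracting the part between the two attachment points leaves \<open>x\<close>,
    \<open>y\<close> and a path neighbour on either side: 1+1+1+1.\<close>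
  have none: "P ! i \<bullet> y = 0" if y: "y \<in> \<Delta> - set P" "y \<noteq> x" and i: "i < m" for y i
  proof (rule ccontr)
    assume iy: "P ! i \<bullet> y \<noteq> 0"
    have i': "1 \<le> i" "Suc i < m" using inner[OF i y(1) iy] by auto
    define s where "s = min i k"
    define t where "t = max i k"
    have st: "1 \<le> s" "s \<le> t" "Suc t < m" using i' k' by (auto simp: s_def t_def)
    let ?Q = "drop s (take (Suc t) P)"
    have Q: "chain ?Q" "set ?Q = (!) P ` {s..t}"
      using st by (intro chain_seg[OF cP(1)]; simp add: m_def)+
    have n: "P ! (s - 1) \<notin> set ?Q" "P ! Suc t \<notin> set ?Q"
      using Q(2) st realizes_nth_eq[OF cP(1)] by (auto simp: m_def)
    have d: "P ! (s - 1) \<in> set P" "P ! Suc t \<in> set P" "P ! (s - 1) \<noteq> P ! Suc t"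
      using st realizes_nth_eq[OF cP(1), of "s - 1" "Suc t"] by (auto simp: m_def)
    have sub: "set ?Q \<subseteq> set P" using Q(2) st by (auto simp: m_def)
    have "{x, y, P ! (s - 1), P ! Suc t} \<subseteq> \<Delta> - set ?Q" using x y d n sub PD by auto
    moreover have "distinct [x, y, P ! (s - 1), P ! Suc t]" using x y d by auto
    moreover have "P ! i \<in> set ?Q" "P ! k \<in> set ?Q" "P ! s \<in> set ?Q" "P ! t \<in> set ?Q"
      using Q(2) st by (auto simp: s_def t_def)
    moreover have "P ! s \<bullet> P ! (s - 1) \<noteq> 0" "P ! t \<bullet> P ! Suc t \<noteq> 0"
      using chain_inner[OF cP(1), of s "s - 1"] chain_inner[OF cP(1), of t "Suc t"] st by (auto simp: m_def)
    ultimately show False using chain_star4[OF Q(1)] iy k(2) by blast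
  qed
  have all: "\<Delta> = insert x (set P)"
  proof (rule ccontr)
    assume "\<Delta> \<noteq> insert x (set P)"
    then obtain u y where "u \<in> insert x (set P)" "y \<in> \<Delta> - insert x (set P)" "u \<bullet> y \<noteq> 0"
      using connected_simpleD[OF conn, of "insert x (set P)"] x PD by auto
    moreover from this have "u \<notin> set P" using none[of y] by (auto simp: in_set_conv_nth m_def)
    ultimately have y: "y \<in> \<Delta> - set P" "y \<noteq> x" "x \<bullet> y \<noteq> 0" by auto
    have cb: "chain [?b, x]" using chain_snoc[of "[?b]" x] chain_single abc PD x k bx by auto
    have xy: "bond x y < 2"
    proof (rule ccontr)
      assume "\<not> bond x y < 2"
      then show False using chain_star3[OF cb, of y ?a ?c] x y abc abcn PD by auto
    qed
    \<comment> \<open>Following a path to the branching vertex and then turning to \<open>x\<close>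
      and \<open>y\<close> gives a path, which cannot be longer than \<open>P\<close>. Used in both
      directions, this forces two vertices of \<open>P\<close> on either side, hence three arms of
      length two.\<close>
    have long: "Suc (Suc (Suc j)) \<le> m" if Q: "chain Q" "set Q \<subseteq> set P" "j < length Q" "Q ! j = ?b" for Q j
    proof -
      let ?T = "take (Suc j) Q"
      have T: "chain ?T" "?T \<noteq> []" "set ?T \<subseteq> set P"
        using Q by (auto simp: realizes_take dest: in_set_takeD)
      have Tl: "last ?T = ?b" using Q(3,4) by (simp add: take_Suc_conv_app_nth)
      have c1: "chain (?T @ [x])" using chain_snoc[OF T(1,2), of x] T(3) Tl x k bx by auto
      have "chain ((?T @ [x]) @ [y])" using chain_snoc[OF c1, of y] T(3) y xy by auto
      then have "length ((?T @ [x]) @ [y]) \<le> m" unfolding m_def by (rule max)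
      then show ?thesis using Q(3) by simp
    qed
    have l1: "Suc (Suc (Suc k)) \<le> m" using long[OF cP(1) order_refl, of k] k by (simp add: m_def)
    have l2: "Suc (Suc (Suc (m - Suc k))) \<le> m"
      using long[OF chain_rev[OF cP(1)], of "m - Suc k"] k by (simp add: m_def rev_nth)
    have k2: "2 \<le> k" "k + 2 < m" using l1 l2 k by linarith+
    let ?Q = "drop (k - 2) (take (Suc (k + 2)) P)"
    have Q: "chain ?Q" "set ?Q = (!) P ` {k - 2..k + 2}"
      using k2 by (intro chain_seg[OF cP(1)]; simp add: m_def)+
    have len: "length ?Q = 5" using k2 by (simp add: m_def)
    have "k - 2 + 2 = k" using k2 by simp
    then have Q2: "?Q ! 2 = ?b" using k2 by (simp add: m_def del: add_2_eq_Suc')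
    have sub: "set ?Q \<subseteq> set P" using Q(2) k2 by (auto simp: m_def)
    have xQ: "x \<in> \<Delta> - set ?Q" using x sub by auto
    have s: "pairing ?b x = - 1" "pairing x ?b = - 1" "pairing x y = - 1" "pairing y x = - 1"
      using single_bond[of ?b x] single_bond[of x y] x y xy bx k abc PD by auto
    have br: "realizes (x # ?Q) (cartan (Suc 2) (- 1) (- 1))"
      using realizes_branch[OF Q(1) xQ, of 2 "- 1" "- 1"] len Q2 k s by simp
    have "realizes ((x # ?Q) @ [y]) (extend (cartan (Suc 2) (- 1) (- 1)) 6 0 (- 1) (- 1))"
    proof (rule realizes_extend[OF br])
      fix j :: nat assume j: "j < 6" "j \<noteq> 0"
      then have "(x # ?Q) ! j \<in> set ?Q" using len nth_mem[of "j - 1" ?Q] by (cases j) auto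
      then have "(x # ?Q) ! j \<in> set P" using sub by blast
      then obtain i where "i < m" "(x # ?Q) ! j = P ! i" unfolding in_set_conv_nth m_def by auto
      then show "(x # ?Q) ! j \<bullet> y = 0" using none[OF y(1,2)] by (simp only:)
    qed (use y sub len s in auto)
    \<comment> \<open>the affine diagram \<open>E\<^sub>6\<close>\<close>
    moreover have "is_null (extend (cartan (Suc 2) (- 1) (- 1)) 6 0 (- 1) (- 1)) [2, 1, 2, 3, 2, 1, 1]"
      by code_simp
    ultimately show False
      using realizes_not_null[of "(x # ?Q) @ [y]" _ "[2, 1, 2, 3, 2, 1, 1]"] len by simp
  qed
  \<comment> \<open>The path is read from the end that puts the shorter arm first, as
    \<open>attains_branch\<close> requires.\<close>
  have "\<exists>Q r. chain Q \<and> set Q = set P \<and> Q ! r = ?b \<and> 1 \<le> r \<and> 2 * r < length Q"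
  proof (cases "2 * k < m")
    case True
    then show ?thesis using cP(1) k' by (intro exI[of _ P] exI[of _ k]) (simp add: m_def)
  next
    case False
    then show ?thesis using chain_rev[OF cP(1)] k'
      by (intro exI[of _ "rev P"] exI[of _ "m - Suc k"]) (auto simp: m_def rev_nth)
  qed
  then obtain Q r where Q: "chain Q" "set Q = set P" "Q ! r = ?b" "1 \<le> r" "2 * r < length Q" by blast
  then obtain c M where "attains (x # Q) c M" using attains_branch[OF Q(1), of x r] x k bx by auto
  then show ?thesis using all Q(2) by (metis list.simps(15))
qed

lemma attains_connected:
  assumes conn: "connected_simple" and card: "card \<Delta> \<ge> 3"
  shows "\<exists>ds c M. set ds = \<Delta> \<and> attains ds c M"
proof -
  have "\<Delta> \<noteq> {}" using card by auto
  then obtain P where P: "maximal_chain P" using maximal_chain_exists by blast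
  then have cP: "chain P" "P \<noteq> []" by (auto simp: maximal_chain_def)
  have h: "last (rev P) = P ! 0" using cP by (simp add: last_rev hd_conv_nth)
  consider x where "x \<in> \<Delta> - set P" "last P \<bullet> x \<noteq> 0"
    | x where "x \<in> \<Delta> - set P" "P ! 0 \<bullet> x \<noteq> 0"
    | "set P = \<Delta>"
    | "set P \<noteq> \<Delta>" "\<And>x. x \<in> \<Delta> - set P \<Longrightarrow> P ! 0 \<bullet> x = 0" "\<And>x. x \<in> \<Delta> - set P \<Longrightarrow> last P \<bullet> x = 0"
    by blast
  then show ?thesis
  proof cases
    case 1
    then show ?thesis using attains_end_branch[OF conn card P] by blast
  next
    case 2
    then show ?thesis using attains_end_branch[OF conn card maximal_chain_rev[OF P], of x] h by simp
  next
    case 3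
    then have "length P \<ge> 3" using card cP by (simp add: realizes_iff distinct_card[symmetric])
    then show ?thesis using attains_A[of P "length P"] cP 3 cartan_A_eq by auto
  next
    case 4
    then show ?thesis using attains_inner_branch[OF conn P] by blast
  qed
qed

end

section \<open>Irreducibility and rank two\<close>

context based_root_system
begin

text \<open>Induction on the height: some simple reflection lowers \<beta> to a positive root, which
  lies in one of the two spans. If \<delta> belongs to that part, adding back its multiple stays
  inside; if not, \<delta> is orthogonal to the span and the reflection changes nothing.\<close>

lemma pos_span_split:
  assumes K: "K \<subseteq> \<Delta>" and orth: "\<And>u v. u \<in> K \<Longrightarrow> v \<in> \<Delta> - K \<Longrightarrow> u \<bullet> v = 0"
    and "\<beta> \<in> pos"
  shows "\<beta> \<in> span K \<or> \<beta> \<in> span (\<Delta> - K)"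
proof -
  have span_fixed: "reflection \<delta> \<gamma> = \<gamma>" if "\<delta> \<in> A" "\<gamma> \<in> span B" "\<And>u v. u \<in> A \<Longrightarrow> v \<in> B \<Longrightarrow> u \<bullet> v = 0"
    for A B \<delta> \<gamma>
  proof -
    have "orthogonal \<delta> \<gamma>" using that by (intro orthogonal_to_span[OF that(2)]) (simp add: orthogonal_def)
    then show ?thesis by (simp add: reflection_def orthogonal_def inner_commute)
  qed
  have "\<beta> \<in> span K \<or> \<beta> \<in> span (\<Delta> - K)" if "\<beta> \<in> pos" "H \<beta> \<le> real n" for n \<beta>
    using that
  proof (induction n arbitrary: \<beta>)
    case 0
    then show ?case using H_pos[of \<beta>] by simp
  next
    case (Suc n)
    show ?case
    proof (cases "\<beta> \<in> \<Delta>")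
      case True
      then show ?thesis by (auto intro: span_base)
    next
      case False
      then obtain \<delta> where d: "\<delta> \<in> \<Delta>" "\<beta> \<bullet> \<delta> > 0" using root_decrease[OF Suc.prems(1)] by blast
      define c where "c = 2 * (\<beta> \<bullet> \<delta>) / (\<delta> \<bullet> \<delta>)"
      have "c > 0" using d simple_nonzero[OF d(1)] by (simp add: c_def)
      moreover have "c \<in> \<int>"
        unfolding c_def using crystallographic d(1) simple_subset pos_root[OF Suc.prems(1)] by blast
      ultimately have "c \<ge> 1" by (auto elim!: Ints_cases)
      have r: "reflection \<delta> \<beta> = \<beta> - c *\<^sub>R \<delta>" by (simp add: reflection_def c_def)
      have "reflection \<delta> \<beta> \<in> pos" using reflection_pos(1)[OF d(1) Suc.prems(1)] d(1) False by blast
      moreover have "H (reflection \<delta> \<beta>) \<le> real n"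
        using Suc.prems(2) \<open>c \<ge> 1\<close> unfolding r H_diff H_scale H_simple[OF d(1)] by simp
      ultimately have "reflection \<delta> \<beta> \<in> span K \<or> reflection \<delta> \<beta> \<in> span (\<Delta> - K)"
        by (rule Suc.IH)
      moreover have "\<beta> \<in> span A" if g: "reflection \<delta> \<beta> \<in> span A" "A = K \<or> A = \<Delta> - K" for A
      proof (cases "\<delta> \<in> A")
        case True
        have "reflection \<delta> \<beta> + c *\<^sub>R \<delta> \<in> span A"
          by (rule span_add[OF g(1) span_scale[OF span_base[OF True]]])
        then show ?thesis by (simp add: r)
      next
        case False
        have "u \<bullet> v = 0" if "u \<in> \<Delta> - A" "v \<in> A" for u v
          using g(2) that orth[of u v] orth[of v u] K by (auto simp: inner_commute)
        then have "reflection \<delta> (reflection \<delta> \<beta>) = reflection \<delta> \<beta>"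
          using d(1) False by (intro span_fixed[OF _ g(1), of _ "\<Delta> - A"]) auto
        then show ?thesis using g(1) by (simp add: reflection_involution)
      qed
      ultimately show ?thesis by blast
    qed
  qed
  then show ?thesis using assms(3) real_arch_simple by blast
qed

lemma irreducible_connected:
  assumes irr: "irreducible_roots \<Phi>"
  shows "connected_simple"
  unfolding connected_simple_def
proof (intro allI impI, rule ccontr)
  fix K assume K: "K \<subset> \<Delta>" "K \<noteq> {}" "\<not> (\<exists>u\<in>K. \<exists>v\<in>\<Delta> - K. u \<bullet> v \<noteq> 0)"
  then have orth: "u \<bullet> v = 0" if "u \<in> K" "v \<in> \<Delta> - K" for u v using that by blast
  let ?A = "\<Phi> \<inter> span K" and ?B = "\<Phi> \<inter> span (\<Delta> - K)"
  have "\<beta> \<in> span K \<or> \<beta> \<in> span (\<Delta> - K)" if "\<beta> \<in> \<Phi>" for \<beta>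
    using root_cases[OF that] pos_span_split[OF psubset_imp_subset[OF K(1)] orth, of \<beta>]
      pos_span_split[OF psubset_imp_subset[OF K(1)] orth, of "- \<beta>"] span_neg[of "- \<beta>"]
    by (auto simp: neg_iff)
  then have un: "?A \<union> ?B = \<Phi>" by blast
  have AB: "\<alpha> \<bullet> \<beta> = 0" if a: "\<alpha> \<in> ?A" and b: "\<beta> \<in> ?B" for \<alpha> \<beta>
  proof -
    have "orthogonal u \<beta>" if "u \<in> K" for u
      using b orth[OF that] by (intro orthogonal_to_span[of \<beta> "\<Delta> - K"]) (auto simp: orthogonal_def)
    then have "orthogonal \<beta> \<alpha>"
      using a by (intro orthogonal_to_span[of \<alpha> K]) (auto simp: orthogonal_commute)
    then show ?thesis by (simp add: orthogonal_def inner_commute)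
  qed
  have "?A \<inter> ?B = {}"
  proof (rule equals0I)
    fix \<alpha> assume "\<alpha> \<in> ?A \<inter> ?B"
    then show False using AB[of \<alpha> \<alpha>] zero_not_root by auto
  qed
  moreover have "?A \<noteq> {}" "?B \<noteq> {}"
  proof -
    obtain u v where "u \<in> K" "v \<in> \<Delta> - K" using K by blast
    then have "u \<in> ?A" "v \<in> ?B" using K(1) simple_subset by (auto intro: span_base)
    then show "?A \<noteq> {}" "?B \<noteq> {}" by blast+
  qed
  moreover have "\<forall>\<alpha>\<in>?A. \<forall>\<beta>\<in>?B. \<alpha> \<bullet> \<beta> = 0" using AB by blast
  ultimately have "\<exists>A B. A \<noteq> {} \<and> B \<noteq> {} \<and> A \<inter> B = {} \<and> A \<union> B = \<Phi> \<and> (\<forall>\<alpha>\<in>A. \<forall>\<beta>\<in>B. \<alpha> \<bullet> \<beta> = 0)"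
    using un by (intro exI[of _ ?A] exI[of _ ?B] conjI)
  then show False using irr unfolding irreducible_roots_def by (elim conjE notE)
qed

lemma dim_roots: "dim \<Phi> = card \<Delta>"
  using dim_eq_card[of \<Delta> \<Phi>] indep span_simple span_roots by simp

text \<open>Both simple roots are inversions of \<open>w0\<close> and have height one. This makes
  the missing value 2 a genuine gap below the maximum.\<close>

lemma longest_rank_2:
  assumes ab: "\<Delta> = {a, b}" "a \<noteq> b" and w0: "longest_element \<Delta> w0"
  shows "2 \<le> L w0"
proof -
  have "{a, b} \<subseteq> pos" using simple_pos ab by auto
  then have "(\<Sum>\<alpha>\<in>{a, b}. H \<alpha>) \<le> (\<Sum>\<alpha>\<in>pos. H \<alpha>)"
    using H_pos by (intro sum_mono2 finite_pos) force+
  also have "\<dots> = real (L w0)"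
    using inversion_longest[OF order_refl w0] by (simp add: L_eq_sum span_simple)
  finally show ?thesis using H_simple ab by simp
qed

lemma L_ne_2_rank_2:
  assumes ab: "\<Delta> = {a, b}" "a \<noteq> b" "a \<bullet> b \<noteq> 0" and w: "w \<in> weyl_group \<Delta>"
  shows "L w \<noteq> 2"
proof
  assume "L w = 2"
  define v where "v = \<rho> - w \<rho>"
  define x y where "x = rep v a" and "y = rep v b"
  have v_sum: "v = \<Sum>(inversion_set \<Phi> \<Delta> w)" using sum_inversion_set[OF w] by (simp add: v_def)
  have "rep v \<delta> \<ge> 0 \<and> rep v \<delta> \<in> \<int>" if "\<delta> \<in> \<Delta>" for \<delta>
    unfolding v_sum rep_sum using that pos_rep rep_int pos_root
    by (intro conjI sum_nonneg Ints_sum) (auto simp: inversion_iff)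
  then have xy: "x \<ge> 0" "x \<in> \<int>" "y \<ge> 0" "y \<in> \<int>" by (auto simp: x_def y_def ab)
  have "H v = 2" using L_eq[OF w] \<open>L w = 2\<close> by (simp add: v_def)
  moreover have "H v = rep v a + rep v b" unfolding H_def using ab(2) by (simp add: ab(1))
  ultimately have sum: "x + y = 2" by (simp add: x_def y_def)
  obtain i j :: int where "x = of_int i" "y = of_int j" using xy by (auto elim!: Ints_cases)
  then have cases: "x = 2 \<and> y = 0 \<or> x = 1 \<and> y = 1 \<or> x = 0 \<and> y = 2"
    using xy sum by (simp, linarith)
  have v: "v = x *\<^sub>R a + y *\<^sub>R b" using rep_expand[of v] ab by (simp add: x_def y_def)
  have nz: "a \<bullet> a > 0" "b \<bullet> b > 0" using simple_nonzero ab by auto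
  have rho: "2 * (\<rho> \<bullet> a) = a \<bullet> a" "2 * (\<rho> \<bullet> b) = b \<bullet> b"
    using rho_coroot[of a] rho_coroot[of b] ab nz by (simp_all add: divide_eq_eq split: if_splits)
  \<comment> \<open>\<open>\<rho> - v\<close> is conjugate to \<open>\<rho>\<close>, so the two have the same norm\<close>
  have "(\<rho> - v) \<bullet> (\<rho> - v) = \<rho> \<bullet> \<rho>" using weyl_isometry[OF w, of \<rho> \<rho>] by (simp add: v_def)
  then have "2 * (\<rho> \<bullet> v) = v \<bullet> v" by (simp add: inner_diff_left inner_diff_right inner_commute)
  then have "x * (2 * (\<rho> \<bullet> a)) + y * (2 * (\<rho> \<bullet> b)) =
      x * x * (a \<bullet> a) + y * y * (b \<bullet> b) + 2 * (x * y * (a \<bullet> b))"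
    by (simp add: v inner_add_left inner_add_right inner_commute algebra_simps)
  \<comment> \<open>If \<open>v\<close> is twice a simple root, the equation says that 2 equals 4
    times the same positive number; if \<open>v\<close> is \<open>a + b\<close>, it says
    \<open>a \<bullet> b = 0\<close>.\<close>
  then show False using cases nz ab(3) unfolding rho by auto
qed

end

theorem theorem6p3:
  fixes \<Phi> \<Delta> :: "'a::euclidean_space set" and w0 :: "'a \<Rightarrow> 'a"
  assumes "root_system \<Phi>" and "irreducible_roots \<Phi>"
    and "simple_roots \<Phi> \<Delta>"
    and "longest_element \<Delta> w0"
  shows "atomic_length \<Phi> \<Delta> ` weyl_group \<Delta> = {0..atomic_length \<Phi> \<Delta> w0} \<longleftrightarrow> dim \<Phi> \<noteq> 2"
proof -
  interpret root_system \<Phi> by (rule assms)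
  interpret based_root_system \<Phi> \<Delta> by unfold_locales (rule assms)
  have conn: "connected_simple" using irreducible_connected[OF assms(2)] .
  show ?thesis
  proof (cases "card \<Delta> = 2")
    case True
    then obtain a b where ab: "\<Delta> = {a, b}" "a \<noteq> b" by (auto simp: card_2_iff)
    have "a \<bullet> b \<noteq> 0" using connected_simpleD[OF conn, of "{a}"] ab by auto
    then have "2 \<notin> L ` weyl_group \<Delta>" using L_ne_2_rank_2[OF ab] by auto
    moreover have "2 \<in> {0..L w0}" using longest_rank_2[OF ab assms(4)] by simp
    ultimately have "L ` weyl_group \<Delta> \<noteq> {0..L w0}" by metis
    then show ?thesis using True dim_roots by simp
  next
    case False
    have "\<exists>ds c M. set ds = \<Delta> \<and> attains ds c M"
    proof (cases "card \<Delta> \<ge> 3")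
      case True
      then show ?thesis by (rule attains_connected[OF conn])
    next
      case small: False
      have "dim \<Phi> = DIM('a)" using dim_span[of \<Phi>] by (simp add: span_roots)
      \<comment> \<open>The ambient dimension is positive, so only rank one remains.\<close>
      then have "card \<Delta> = 1" using small False dim_roots DIM_positive[where 'a = 'a] by linarith
      then obtain d where d: "\<Delta> = {d}" by (auto simp: card_1_singleton_iff)
      then show ?thesis
        using attains_A1[of "[d]"] chain_single[of d] by (auto simp: cartan_A_eq intro!: exI[of _ "[d]"])
    qed
    then obtain ds c M where "set ds = \<Delta>" "attains ds c M" by blast
    then have "L ` weyl_group \<Delta> = {0..L w0}" using attains_longest[of ds c M w0] assms(4) by simp
    then show ?thesis using False dim_roots by simp
  qed
qed

end
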